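(* Let $L$ be a metric signature. Every (continuous) Palyutin formula $\varphi(x)$ in $L$ is bipreserved under reduced products; that is, for every family $M=(M_i)_{i\in I}$ of $L$-structures, every filter $F$ on $I$ and every tuple $a\in\prod_i M_i^x$, \[\varphi^{M_F}(a_F)=\limsup_{i\to F}\varphi^{M_i}(a_i).\]
   Context: Continuous first-order logic. The domains of (metric) $L$-structures are nonempty complete bounded metric spaces; predicates are bounded uniformly continuous real-valued maps, with bounds and moduli of uniform continuity prescribed by the signature. Formulas are built from atomic formulas (predicates, including the metric $d$, applied to terms) using continuous connectives $\mathbb R^n\to\mathbb R$ and the quantifiers $\sup,\inf$; formulas are $\mathbb R$-valued. A unary connective is a continuous map $\mathbb R\to\mathbb R$. All filters are proper filters on nonempty sets. For a bounded family of reals, $\limsup_{i\to F}u_i=\inf_{J\in F}\sup_{i\in J}u_i$. Reduced products: on $\prod_i M_i$ let $d_F(a,b)=\limsup_{i\to F}d^{M_i}(a_i,b_i)$. The reduced product $M_F=\prod_i M_i/F$ has as domain the quotient of $\prod_iM_i$ by $d_F(a,b)=0$ (a complete bounded metric space); $a_F$ denotes the image of $a$; constants and functions are interpreted coordinatewise, and $p^{M_F}(a_F)=\limsup_{i\to F}p^{M_i}(a_i)$ for predicate symbols $p$. A formula $\varphi(x)$ is preserved under reduced products if always $\varphi^{M_F}(a_F)\le\limsup_{i\to F}\varphi^{M_i}(a_i)$, copreserved if always $\limsup_{i\to F}\varphi^{M_i}(a_i)\le\varphi^{M_F}(a_F)$, and bipreserved if both. Palyutin formulas: the smallest set of formulas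 such that (1) every atomic formula is Palyutin; (2) if $\varphi$ is Palyutin and $C$ is a nondecreasing unary connective, then $C\varphi$ is Palyutin; (3) if $\varphi,\psi$ are Palyutin, so is $\max(\varphi,\psi)$; (4) if $\varphi$ is Palyutin and $x$ is a variable, $\inf_x\varphi$ and $\sup_x\varphi$ are Palyutin; (5) if $\varphi,\psi$ are Palyutin, $D$ is a nonincreasing unary connective with (necessarily unique) fixed point $\Delta$, and $x$ is a variable, then $\max(\inf_x\varphi,\ \sup_x\min(D\varphi,\Delta,\psi))$ is Palyutin. *)

theory Defs
  imports "HOL-Analysis.Analysis"
begin

section \<open>Metric signatures and structures\<close>

text \<open>
  Symbols are drawn from the types \<^typ>\<open>'f\<close> and \<^typ>\<open>'p\<close>; the sets \<open>funs\<close> and \<open>preds\<close> (possibly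
  empty) say which of them belong to the signature. Constants are function symbols of arity 0.
  A modulus of uniform continuity is a map \<open>\<delta>\<close> sending each \<open>\<epsilon> > 0\<close> to some \<open>\<delta> \<epsilon> > 0\<close>; a bound
  on the metric is prescribed as for any other predicate.
\<close>

record ('f, 'p) signature =
  funs :: "'f set"
  preds :: "'p set"
  farity :: "'f \<Rightarrow> nat"
  parity :: "'p \<Rightarrow> nat"
  fmodulus :: "'f \<Rightarrow> real \<Rightarrow> real"
  pmodulus :: "'p \<Rightarrow> real \<Rightarrow> real"
  pbound :: "'p \<Rightarrow> real"
  dbound :: real

definition metric_signature :: "('f, 'p) signature \<Rightarrow> bool" where
  "metric_signature L \<longleftrightarrow>
     (\<forall>f\<in>funs L. \<forall>\<epsilon>>0. fmodulus L f \<epsilon> > 0) \<and>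
     (\<forall>p\<in>preds L. \<forall>\<epsilon>>0. pmodulus L p \<epsilon> > 0)"

record ('f, 'p, 'a) mstruct =
  universe :: "'a set"
  mdst :: "'a \<Rightarrow> 'a \<Rightarrow> real"
  fint :: "'f \<Rightarrow> 'a list \<Rightarrow> 'a"
  pint :: "'p \<Rightarrow> 'a list \<Rightarrow> real"

definition tuples :: "'a set \<Rightarrow> nat \<Rightarrow> 'a list set" where
  "tuples A n = {xs. set xs \<subseteq> A \<and> length xs = n}"

definition L_structure :: "('f, 'p) signature \<Rightarrow> ('f, 'p, 'a) mstruct \<Rightarrow> bool" where
  "L_structure L M \<longleftrightarrow>
     universe M \<noteq> {} \<and>
     Metric_space (universe M) (mdst M) \<and>
     Metric_space.mcomplete (universe M) (mdst M) \<and>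
     (\<forall>a\<in>universe M. \<forall>b\<in>universe M. mdst M a b \<le> dbound L) \<and>
     (\<forall>f\<in>funs L. \<forall>xs\<in>tuples (universe M) (farity L f). fint M f xs \<in> universe M) \<and>
     (\<forall>f\<in>funs L. \<forall>\<epsilon>>0.
        \<forall>xs\<in>tuples (universe M) (farity L f). \<forall>ys\<in>tuples (universe M) (farity L f).
          (\<forall>k<farity L f. mdst M (xs ! k) (ys ! k) < fmodulus L f \<epsilon>) \<longrightarrow>
            mdst M (fint M f xs) (fint M f ys) \<le> \<epsilon>) \<and>
     (\<forall>p\<in>preds L. \<forall>xs\<in>tuples (universe M) (parity L p). \<bar>pint M p xs\<bar> \<le> pbound L p) \<and>
     (\<forall>p\<in>preds L. \<forall>\<epsilon>>0.
        \<forall>xs\<in>tuples (universe M) (parity L p). \<forall>ys\<in>tuples (universe M) (parity L p).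
          (\<forall>k<parity L p. mdst M (xs ! k) (ys ! k) < pmodulus L p \<epsilon>) \<longrightarrow>
            \<bar>pint M p xs - pint M p ys\<bar> \<le> \<epsilon>)"


section \<open>Formulas\<close>

datatype 'f trm = Var nat | Fun 'f "'f trm list"

text \<open>In \<open>Conn C \<phi>s\<close> only the values of \<open>C\<close> at lists of the same length as \<open>\<phi>s\<close> matter.\<close>

datatype ('f, 'p) fm =
    Pred 'p "'f trm list"
  | Dist "'f trm" "'f trm"
  | Conn "real list \<Rightarrow> real" "('f, 'p) fm list"
  | Sup_fm nat "('f, 'p) fm"
  | Inf_fm nat "('f, 'p) fm"

fun wf_trm :: "('f, 'p) signature \<Rightarrow> 'f trm \<Rightarrow> bool" where
  "wf_trm L (Var v) \<longleftrightarrow> True"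
| "wf_trm L (Fun f ts) \<longleftrightarrow> f \<in> funs L \<and> length ts = farity L f \<and> (\<forall>t\<in>set ts. wf_trm L t)"

text \<open>
  A connective is a continuous map from \<open>\<real>\<^sup>n\<close> to \<open>\<real>\<close>. Here \<open>\<real>\<^sup>n\<close> is the set of real lists of
  length \<open>n\<close>, the image of \<open>\<real>\<^sup>\<nat>\<close> with the product topology under truncation to the first \<open>n\<close>
  coordinates; as truncation is a quotient map onto \<open>\<real>\<^sup>n\<close>, continuity may be tested on \<open>\<real>\<^sup>\<nat>\<close>.
\<close>

definition connective :: "nat \<Rightarrow> (real list \<Rightarrow> real) \<Rightarrow> bool" where
  "connective n C \<longleftrightarrow> continuous_on UNIV (\<lambda>x :: nat \<Rightarrow> real. C (map x [0..<n]))"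

fun wf_fm :: "('f, 'p) signature \<Rightarrow> ('f, 'p) fm \<Rightarrow> bool" where
  "wf_fm L (Pred p ts) \<longleftrightarrow> p \<in> preds L \<and> length ts = parity L p \<and> (\<forall>t\<in>set ts. wf_trm L t)"
| "wf_fm L (Dist t u) \<longleftrightarrow> wf_trm L t \<and> wf_trm L u"
| "wf_fm L (Conn C \<phi>s) \<longleftrightarrow> connective (length \<phi>s) C \<and> (\<forall>\<phi>\<in>set \<phi>s. wf_fm L \<phi>)"
| "wf_fm L (Sup_fm v \<phi>) \<longleftrightarrow> wf_fm L \<phi>"
| "wf_fm L (Inf_fm v \<phi>) \<longleftrightarrow> wf_fm L \<phi>"

fun vars_trm :: "'f trm \<Rightarrow> nat set" where
  "vars_trm (Var v) = {v}"
| "vars_trm (Fun f ts) = (\<Union>t\<in>set ts. vars_trm t)"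

fun free_vars :: "('f, 'p) fm \<Rightarrow> nat set" where
  "free_vars (Pred p ts) = (\<Union>t\<in>set ts. vars_trm t)"
| "free_vars (Dist t u) = vars_trm t \<union> vars_trm u"
| "free_vars (Conn C \<phi>s) = (\<Union>\<phi>\<in>set \<phi>s. free_vars \<phi>)"
| "free_vars (Sup_fm v \<phi>) = free_vars \<phi> - {v}"
| "free_vars (Inf_fm v \<phi>) = free_vars \<phi> - {v}"

fun trm_val :: "('f, 'p, 'a) mstruct \<Rightarrow> (nat \<Rightarrow> 'a) \<Rightarrow> 'f trm \<Rightarrow> 'a" where
  "trm_val M s (Var v) = s v"
| "trm_val M s (Fun f ts) = fint M f (map (trm_val M s) ts)"

fun fm_val :: "('f, 'p, 'a) mstruct \<Rightarrow> (nat \<Rightarrow> 'a) \<Rightarrow> ('f, 'p) fm \<Rightarrow> real" where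
  "fm_val M s (Pred p ts) = pint M p (map (trm_val M s) ts)"
| "fm_val M s (Dist t u) = mdst M (trm_val M s t) (trm_val M s u)"
| "fm_val M s (Conn C \<phi>s) = C (map (fm_val M s) \<phi>s)"
| "fm_val M s (Sup_fm v \<phi>) = (SUP b\<in>universe M. fm_val M (s(v := b)) \<phi>)"
| "fm_val M s (Inf_fm v \<phi>) = (INF b\<in>universe M. fm_val M (s(v := b)) \<phi>)"


section \<open>Palyutin formulas\<close>

definition Const_fm :: "real \<Rightarrow> ('f, 'p) fm" where
  "Const_fm c = Conn (\<lambda>_. c) []"

definition Unary_fm :: "(real \<Rightarrow> real) \<Rightarrow> ('f, 'p) fm \<Rightarrow> ('f, 'p) fm" where
  "Unary_fm C \<phi> = Conn (\<lambda>rs. C (rs ! 0)) [\<phi>]"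

definition Max_fm :: "('f, 'p) fm \<Rightarrow> ('f, 'p) fm \<Rightarrow> ('f, 'p) fm" where
  "Max_fm \<phi> \<psi> = Conn (\<lambda>rs. max (rs ! 0) (rs ! 1)) [\<phi>, \<psi>]"

definition Min_fm :: "('f, 'p) fm \<Rightarrow> ('f, 'p) fm \<Rightarrow> ('f, 'p) fm" where
  "Min_fm \<phi> \<psi> = Conn (\<lambda>rs. min (rs ! 0) (rs ! 1)) [\<phi>, \<psi>]"

inductive palyutin :: "('f, 'p) signature \<Rightarrow> ('f, 'p) fm \<Rightarrow> bool" for L where
  palyutin_Pred: "wf_fm L (Pred p ts) \<Longrightarrow> palyutin L (Pred p ts)"
| palyutin_Dist: "wf_fm L (Dist t u) \<Longrightarrow> palyutin L (Dist t u)"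
| palyutin_Unary: "palyutin L \<phi> \<Longrightarrow> continuous_on UNIV C \<Longrightarrow> mono C \<Longrightarrow> palyutin L (Unary_fm C \<phi>)"
| palyutin_Max: "palyutin L \<phi> \<Longrightarrow> palyutin L \<psi> \<Longrightarrow> palyutin L (Max_fm \<phi> \<psi>)"
| palyutin_Inf: "palyutin L \<phi> \<Longrightarrow> palyutin L (Inf_fm v \<phi>)"
| palyutin_Sup: "palyutin L \<phi> \<Longrightarrow> palyutin L (Sup_fm v \<phi>)"
| palyutin_Rel: "palyutin L \<phi> \<Longrightarrow> palyutin L \<psi> \<Longrightarrow> continuous_on UNIV D \<Longrightarrow> antimono D \<Longrightarrow> D \<Delta> = \<Delta> \<Longrightarrow>
    palyutin L (Max_fm (Inf_fm v \<phi>)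
                       (Sup_fm v (Min_fm (Unary_fm D \<phi>) (Min_fm (Const_fm \<Delta>) \<psi>))))"

lemma connective_Const: "connective 0 (\<lambda>_. c)"
  by (simp add: connective_def)

lemma connective_Unary: "continuous_on UNIV C \<Longrightarrow> connective (Suc 0) (\<lambda>rs. C (rs ! 0))"
  unfolding connective_def
  by (simp, rule continuous_on_compose2[OF _ continuous_on_product_coordinates]) auto

lemma connective_Max: "connective (Suc (Suc 0)) (\<lambda>rs. max (rs ! 0) (rs ! 1))"
  unfolding connective_def by (simp, intro continuous_on_max continuous_on_product_coordinates)

lemma connective_Min: "connective (Suc (Suc 0)) (\<lambda>rs. min (rs ! 0) (rs ! 1))"
  unfolding connective_def by (simp, intro continuous_on_min continuous_on_product_coordinates)

lemma palyutin_wf: "palyutin L \<phi> \<Longrightarrow> wf_fm L \<phi>"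
  by (induction rule: palyutin.induct)
     (simp_all del: One_nat_def add: Unary_fm_def Max_fm_def Min_fm_def Const_fm_def
        connective_Const connective_Unary connective_Max connective_Min)


section \<open>Reduced products\<close>

text \<open>
  \<^const>\<open>Limsup\<close> needs a complete lattice, so the limit superior of a bounded real family is
  defined here. The sets \<open>J\<close> range over the members of the filter.
\<close>

definition rlimsup :: "'i filter \<Rightarrow> ('i \<Rightarrow> real) \<Rightarrow> real" where
  "rlimsup F u = (INF J\<in>{J. eventually (\<lambda>i. i \<in> J) F}. SUP i\<in>J. u i)"

definition prod_dom :: "('i \<Rightarrow> ('f, 'p, 'a) mstruct) \<Rightarrow> ('i \<Rightarrow> 'a) set" where
  "prod_dom M = {a. \<forall>i. a i \<in> universe (M i)}"

definition prod_dst :: "'i filter \<Rightarrow> ('i \<Rightarrow> ('f, 'p, 'a) mstruct) \<Rightarrow> ('i \<Rightarrow> 'a) \<Rightarrow> ('i \<Rightarrow> 'a) \<Rightarrow> real" where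
  "prod_dst F M a b = rlimsup F (\<lambda>i. mdst (M i) (a i) (b i))"

definition rp_rel :: "'i filter \<Rightarrow> ('i \<Rightarrow> ('f, 'p, 'a) mstruct) \<Rightarrow> (('i \<Rightarrow> 'a) \<times> ('i \<Rightarrow> 'a)) set" where
  "rp_rel F M = {(a, b). a \<in> prod_dom M \<and> b \<in> prod_dom M \<and> prod_dst F M a b = 0}"

text \<open>\<open>rp_class F M a\<close> is the image \<open>a\<^sub>F\<close> of \<open>a\<close> in the reduced product.\<close>

definition rp_class :: "'i filter \<Rightarrow> ('i \<Rightarrow> ('f, 'p, 'a) mstruct) \<Rightarrow> ('i \<Rightarrow> 'a) \<Rightarrow> ('i \<Rightarrow> 'a) set" where
  "rp_class F M a = rp_rel F M `` {a}"

definition rep :: "'b set \<Rightarrow> 'b" where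
  "rep X = (SOME a. a \<in> X)"

text \<open>
  The interpretations are defined through chosen representatives; the lemmas \<open>mdst_reduced\<close>,
  \<open>pint_reduced\<close> and \<open>fint_reduced\<close> below show that the choice is immaterial. The metric is
  set to 0 off the domain because \<^locale>\<open>Metric_space\<close> asks for nonnegativity everywhere.
\<close>

definition reduced_product ::
  "'i filter \<Rightarrow> ('i \<Rightarrow> ('f, 'p, 'a) mstruct) \<Rightarrow> ('f, 'p, ('i \<Rightarrow> 'a) set) mstruct" where
  "reduced_product F M =
     \<lparr> universe = prod_dom M // rp_rel F M,
       mdst = (\<lambda>X Y. if X \<in> prod_dom M // rp_rel F M \<and> Y \<in> prod_dom M // rp_rel F M
                      then prod_dst F M (rep X) (rep Y) else 0),
       fint = (\<lambda>f Xs. rp_class F M (\<lambda>i. fint (M i) f (map (\<lambda>X. rep X i) Xs))),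
       pint = (\<lambda>p Xs. rlimsup F (\<lambda>i. pint (M i) p (map (\<lambda>X. rep X i) Xs))) \<rparr>"


subsection \<open>Independence of the representatives\<close>

lemma rlimsup_le:
  assumes "F \<noteq> bot" "\<And>i. \<bar>u i\<bar> \<le> B" "eventually (\<lambda>i. u i \<le> c) F"
  shows "rlimsup F u \<le> c"
proof -
  have bdd: "bdd_above (u ` J)" for J
    using assms(2) by (intro bdd_aboveI[of _ B]) (auto simp: abs_le_iff)
  have ne: "J \<noteq> {}" if "eventually (\<lambda>i. i \<in> J) F" for J
    using that assms(1) by (auto simp: trivial_limit_def)
  have "bdd_below ((\<lambda>J. SUP i\<in>J. u i) ` {J. eventually (\<lambda>i. i \<in> J) F})"
  proof (rule bdd_belowI2[where m = "- B"])
    fix J assume "J \<in> {J. eventually (\<lambda>i. i \<in> J) F}"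
    then obtain j where "j \<in> J" using ne by auto
    then have "u j \<le> (SUP i\<in>J. u i)" by (intro cSUP_upper bdd)
    moreover have "- B \<le> u j" using assms(2)[of j] by linarith
    ultimately show "- B \<le> (SUP i\<in>J. u i)" by linarith
  qed
  then have "rlimsup F u \<le> (SUP i\<in>{i. u i \<le> c}. u i)"
    unfolding rlimsup_def using assms(3) by (intro cINF_lower) auto
  also have "\<dots> \<le> c"
    using ne[of "{i. u i \<le> c}"] assms(3) by (intro cSUP_least) auto
  finally show ?thesis .
qed

lemma eventually_rlimsup_less:
  assumes "F \<noteq> bot" "\<And>i. \<bar>u i\<bar> \<le> B" "rlimsup F u < c"
  shows "eventually (\<lambda>i. u i < c) F"
proof -
  have "(INF J\<in>{J. eventually (\<lambda>i. i \<in> J) F}. SUP i\<in>J. u i) < c"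
    using assms(3) by (simp add: rlimsup_def)
  moreover have "{J. eventually (\<lambda>i. i \<in> J) F} \<noteq> {}"
    by (auto intro!: exI[of _ UNIV])
  ultimately obtain J where J: "eventually (\<lambda>i. i \<in> J) F" "(SUP i\<in>J. u i) < c"
    by (rule_tac cInf_lessD[of "(\<lambda>J. SUP i\<in>J. u i) ` {J. eventually (\<lambda>i. i \<in> J) F}" c, THEN bexE]) auto
  have "u i < c" if "i \<in> J" for i
  proof -
    have "u i \<le> (SUP i\<in>J. u i)"
      using that assms(2) by (intro cSUP_upper bdd_aboveI[of _ B]) (auto simp: abs_le_iff)
    then show ?thesis using J(2) by linarith
  qed
  then show ?thesis by (rule eventually_mono[OF J(1)])
qed

lemma rlimsup_le_add:
  assumes "F \<noteq> bot" "\<And>i. \<bar>u i\<bar> \<le> B" "\<And>i. \<bar>w i\<bar> \<le> B'"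
    and "eventually (\<lambda>i. u i \<le> w i + c) F"
  shows "rlimsup F u \<le> rlimsup F w + c"
proof (rule field_le_epsilon)
  fix \<epsilon> :: real assume "\<epsilon> > 0"
  then have "eventually (\<lambda>i. w i < rlimsup F w + \<epsilon>) F"
    by (intro eventually_rlimsup_less[OF assms(1,3)]) simp
  then have "eventually (\<lambda>i. u i \<le> rlimsup F w + c + \<epsilon>) F"
    using assms(4) by eventually_elim linarith
  then show "rlimsup F u \<le> rlimsup F w + c + \<epsilon>"
    by (rule rlimsup_le[OF assms(1,2)])
qed

lemma rlimsup_nonneg:
  assumes "F \<noteq> bot" "\<And>i. \<bar>u i\<bar> \<le> B" "\<And>i. 0 \<le> u i"
  shows "0 \<le> rlimsup F u"
proof (rule ccontr)
  assume "\<not> 0 \<le> rlimsup F u"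
  then have "eventually (\<lambda>i. u i < 0) F"
    using assms by (intro eventually_rlimsup_less) auto
  then obtain i where "u i < 0"
    using eventually_happens'[OF assms(1)] by blast
  then show False using assms(3)[of i] by linarith
qed

locale structure_family =
  fixes L :: "('f, 'p) signature" and F :: "'i filter" and M :: "'i \<Rightarrow> ('f, 'p, 'a) mstruct"
  assumes sig: "metric_signature L" and proper: "F \<noteq> bot" and struct: "\<And>i. L_structure L (M i)"
begin

lemma metric_i: "Metric_space (universe (M i)) (mdst (M i))"
  using struct[of i] by (simp add: L_structure_def)

lemma dst_bound: "a \<in> universe (M i) \<Longrightarrow> b \<in> universe (M i) \<Longrightarrow> \<bar>mdst (M i) a b\<bar> \<le> dbound L"
  using struct[of i] Metric_space.nonneg[OF metric_i[of i]] by (auto simp: L_structure_def)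

lemma prod_dst_bound:
  "a \<in> prod_dom M \<Longrightarrow> b \<in> prod_dom M \<Longrightarrow> \<bar>mdst (M i) (a i) (b i)\<bar> \<le> dbound L"
  by (rule dst_bound) (auto simp: prod_dom_def)

lemma prod_dst_less:
  "a \<in> prod_dom M \<Longrightarrow> b \<in> prod_dom M \<Longrightarrow> prod_dst F M a b < c \<Longrightarrow>
     eventually (\<lambda>i. mdst (M i) (a i) (b i) < c) F"
  unfolding prod_dst_def by (rule eventually_rlimsup_less[OF proper prod_dst_bound])

lemma prod_dst_le:
  "a \<in> prod_dom M \<Longrightarrow> b \<in> prod_dom M \<Longrightarrow> eventually (\<lambda>i. mdst (M i) (a i) (b i) \<le> c) F \<Longrightarrow>
     prod_dst F M a b \<le> c"
  unfolding prod_dst_def by (rule rlimsup_le[OF proper prod_dst_bound])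

lemma prod_dst_nonneg: "a \<in> prod_dom M \<Longrightarrow> b \<in> prod_dom M \<Longrightarrow> 0 \<le> prod_dst F M a b"
  unfolding prod_dst_def
  by (rule rlimsup_nonneg[OF proper prod_dst_bound])
     (auto intro: Metric_space.nonneg[OF metric_i])

lemma prod_dst_commute: "prod_dst F M a b = prod_dst F M b a"
  unfolding prod_dst_def by (simp add: Metric_space.commute[OF metric_i])

lemma prod_dst_refl: "a \<in> prod_dom M \<Longrightarrow> prod_dst F M a a = 0"
  by (intro antisym prod_dst_le prod_dst_nonneg)
     (auto simp: prod_dom_def Metric_space.mdist_zero[OF metric_i])

lemma prod_dst_triangle:
  assumes "a \<in> prod_dom M" "b \<in> prod_dom M" "c \<in> prod_dom M"
  shows "prod_dst F M a c \<le> prod_dst F M a b + prod_dst F M b c"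
proof (rule field_le_epsilon)
  fix \<epsilon> :: real assume "\<epsilon> > 0"
  then have "eventually (\<lambda>i. mdst (M i) (a i) (b i) < prod_dst F M a b + \<epsilon>/2) F"
    "eventually (\<lambda>i. mdst (M i) (b i) (c i) < prod_dst F M b c + \<epsilon>/2) F"
    using assms by (auto intro!: prod_dst_less)
  then have "eventually (\<lambda>i. mdst (M i) (a i) (c i) \<le> prod_dst F M a b + prod_dst F M b c + \<epsilon>) F"
  proof eventually_elim
    case (elim i)
    have "mdst (M i) (a i) (c i) \<le> mdst (M i) (a i) (b i) + mdst (M i) (b i) (c i)"
      using assms by (intro Metric_space.triangle[OF metric_i]) (auto simp: prod_dom_def)
    then show ?case using elim by linarith
  qed
  then show "prod_dst F M a c \<le> prod_dst F M a b + prod_dst F M b c + \<epsilon>"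
    using assms by (intro prod_dst_le)
qed

lemma equiv_rp_rel: "equiv (prod_dom M) (rp_rel F M)"
proof (rule equivI)
  show "rp_rel F M \<subseteq> prod_dom M \<times> prod_dom M" by (auto simp: rp_rel_def)
  show "refl_on (prod_dom M) (rp_rel F M)"
    by (auto simp: refl_on_def rp_rel_def prod_dst_refl)
  show "sym (rp_rel F M)" by (auto simp: sym_def rp_rel_def prod_dst_commute)
  show "trans (rp_rel F M)"
  proof (rule transI)
    fix a b c assume "(a, b) \<in> rp_rel F M" "(b, c) \<in> rp_rel F M"
    then show "(a, c) \<in> rp_rel F M"
      using prod_dst_triangle[of a b c] prod_dst_nonneg[of a c] by (auto simp: rp_rel_def)
  qed
qed

lemma universe_reduced: "universe (reduced_product F M) = rp_class F M ` prod_dom M"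
  by (auto simp: reduced_product_def quotient_def rp_class_def)

lemma rep_rp_class:
  assumes "a \<in> prod_dom M"
  shows "(a, rep (rp_class F M a)) \<in> rp_rel F M"
proof -
  have "a \<in> rp_class F M a"
    using assms by (auto simp: rp_class_def rp_rel_def prod_dst_refl)
  then have "rep (rp_class F M a) \<in> rp_class F M a" unfolding rep_def by (rule someI[of "\<lambda>b. b \<in> rp_class F M a"])
  then show ?thesis by (simp add: rp_class_def)
qed

lemma rep_prod_dom: "a \<in> prod_dom M \<Longrightarrow> rep (rp_class F M a) \<in> prod_dom M"
  using rep_rp_class[of a] by (auto simp: rp_rel_def)

lemma rp_class_eq_iff:
  "a \<in> prod_dom M \<Longrightarrow> b \<in> prod_dom M \<Longrightarrow> rp_class F M a = rp_class F M b \<longleftrightarrow> prod_dst F M a b = 0"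
  unfolding rp_class_def using eq_equiv_class_iff[OF equiv_rp_rel, of a b] by (auto simp: rp_rel_def)

lemma mdst_reduced:
  assumes "a \<in> prod_dom M" "b \<in> prod_dom M"
  shows "mdst (reduced_product F M) (rp_class F M a) (rp_class F M b) =
           rlimsup F (\<lambda>i. mdst (M i) (a i) (b i))"
proof -
  let ?a = "rep (rp_class F M a)" and ?b = "rep (rp_class F M b)"
  have r: "prod_dst F M a ?a = 0" "prod_dst F M b ?b = 0" "?a \<in> prod_dom M" "?b \<in> prod_dom M"
    using assms rep_rp_class[of a] rep_rp_class[of b] by (auto simp: rp_rel_def)
  have "prod_dst F M ?a ?b = prod_dst F M a b"
    using prod_dst_triangle[of ?a a ?b] prod_dst_triangle[of a b ?b]
      prod_dst_triangle[of a ?a b] prod_dst_triangle[of ?a ?b b] r assms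
      prod_dst_commute[of a ?a] prod_dst_commute[of b ?b] by linarith
  then show ?thesis
    using assms by (auto simp: reduced_product_def prod_dst_def rp_class_def quotientI)
qed

lemma eventually_reps_close:
  assumes "\<And>a. a \<in> set as \<Longrightarrow> a \<in> prod_dom M" "\<delta> > 0"
  shows "eventually (\<lambda>i. \<forall>k<length as.
           mdst (M i) (map (\<lambda>a. a i) as ! k) (map (\<lambda>a. rep (rp_class F M a) i) as ! k) < \<delta>) F"
proof -
  have "eventually (\<lambda>i. \<forall>a\<in>set as. mdst (M i) (a i) (rep (rp_class F M a) i) < \<delta>) F"
    using assms rep_rp_class by (intro eventually_ball_finite ballI prod_dst_less) (auto simp: rp_rel_def)
  then show ?thesis by (rule eventually_mono) auto
qed

lemma map_in_tuples:
  assumes "\<And>a. a \<in> set as \<Longrightarrow> a \<in> prod_dom M"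
  shows "map (\<lambda>a. a i) as \<in> tuples (universe (M i)) (length as)"
    "map (\<lambda>a. rep (rp_class F M a) i) as \<in> tuples (universe (M i)) (length as)"
  using assms rep_prod_dom by (auto simp: tuples_def prod_dom_def)

lemma pint_reduced:
  assumes p: "p \<in> preds L" "length as = parity L p" and as: "\<And>a. a \<in> set as \<Longrightarrow> a \<in> prod_dom M"
  shows "pint (reduced_product F M) p (map (rp_class F M) as) =
           rlimsup F (\<lambda>i. pint (M i) p (map (\<lambda>a. a i) as))"
proof -
  let ?u = "\<lambda>i. pint (M i) p (map (\<lambda>a. a i) as)"
  let ?w = "\<lambda>i. pint (M i) p (map (\<lambda>a. rep (rp_class F M a) i) as)"
  have tup: "map (\<lambda>a. a i) as \<in> tuples (universe (M i)) (parity L p)"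
    "map (\<lambda>a. rep (rp_class F M a) i) as \<in> tuples (universe (M i)) (parity L p)" for i
    using map_in_tuples[of as, OF as] p(2) by auto
  have bd: "\<bar>?u i\<bar> \<le> pbound L p" "\<bar>?w i\<bar> \<le> pbound L p" for i
    using struct[of i] p(1) tup[of i] by (auto simp: L_structure_def)
  have ev: "eventually (\<lambda>i. \<bar>?u i - ?w i\<bar> \<le> \<epsilon>) F" if "\<epsilon> > 0" for \<epsilon>
  proof -
    have "pmodulus L p \<epsilon> > 0" using sig p(1) that by (auto simp: metric_signature_def)
    then have "eventually (\<lambda>i. \<forall>k<parity L p. mdst (M i) (map (\<lambda>a. a i) as ! k)
        (map (\<lambda>a. rep (rp_class F M a) i) as ! k) < pmodulus L p \<epsilon>) F"
      using eventually_reps_close[of as "pmodulus L p \<epsilon>", OF as] p(2) by simp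
    then show ?thesis
    proof (rule eventually_mono, goal_cases)
      case (1 i)
      then show ?case
        using struct[of i] p tup[of i] that unfolding L_structure_def by auto
    qed
  qed
  have "rlimsup F ?w = rlimsup F ?u"
  proof (rule antisym; rule field_le_epsilon)
    fix \<epsilon> :: real assume "\<epsilon> > 0"
    note ev' = ev[OF this]
    show "rlimsup F ?w \<le> rlimsup F ?u + \<epsilon>"
      by (rule rlimsup_le_add[OF proper bd(2) bd(1)], rule eventually_mono[OF ev']) linarith
    show "rlimsup F ?u \<le> rlimsup F ?w + \<epsilon>"
      by (rule rlimsup_le_add[OF proper bd(1) bd(2)], rule eventually_mono[OF ev']) linarith
  qed
  then show ?thesis by (simp add: reduced_product_def comp_def)
qed

lemma fint_reduced:
  assumes f: "f \<in> funs L" "length as = farity L f" and as: "\<And>a. a \<in> set as \<Longrightarrow> a \<in> prod_dom M"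
  shows "(\<lambda>i. fint (M i) f (map (\<lambda>a. a i) as)) \<in> prod_dom M"
    and "fint (reduced_product F M) f (map (rp_class F M) as) =
           rp_class F M (\<lambda>i. fint (M i) f (map (\<lambda>a. a i) as))"
proof -
  let ?u = "\<lambda>i. fint (M i) f (map (\<lambda>a. a i) as)"
  let ?w = "\<lambda>i. fint (M i) f (map (\<lambda>a. rep (rp_class F M a) i) as)"
  have tup: "map (\<lambda>a. a i) as \<in> tuples (universe (M i)) (farity L f)"
    "map (\<lambda>a. rep (rp_class F M a) i) as \<in> tuples (universe (M i)) (farity L f)" for i
    using map_in_tuples[of as, OF as] f(2) by auto
  show u: "?u \<in> prod_dom M"
    unfolding prod_dom_def
  proof (intro CollectI allI)
    fix i show "?u i \<in> universe (M i)"
      using struct[of i] f(1) tup[of i] by (auto simp: L_structure_def)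
  qed
  have w: "?w \<in> prod_dom M"
    unfolding prod_dom_def
  proof (intro CollectI allI)
    fix i show "?w i \<in> universe (M i)"
      using struct[of i] f(1) tup[of i] by (auto simp: L_structure_def)
  qed
  have ev: "eventually (\<lambda>i. mdst (M i) (?u i) (?w i) \<le> \<epsilon>) F" if "\<epsilon> > 0" for \<epsilon>
  proof -
    have "fmodulus L f \<epsilon> > 0" using sig f(1) that by (auto simp: metric_signature_def)
    then have "eventually (\<lambda>i. \<forall>k<farity L f. mdst (M i) (map (\<lambda>a. a i) as ! k)
        (map (\<lambda>a. rep (rp_class F M a) i) as ! k) < fmodulus L f \<epsilon>) F"
      using eventually_reps_close[of as "fmodulus L f \<epsilon>", OF as] f(2) by simp
    then show ?thesis
    proof (rule eventually_mono, goal_cases)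
      case (1 i)
      then show ?case
        using struct[of i] f tup[of i] that unfolding L_structure_def by auto
    qed
  qed
  have "prod_dst F M ?u ?w \<le> 0"
    by (rule field_le_epsilon) (auto intro!: prod_dst_le[OF u w] ev)
  then have "rp_class F M ?u = rp_class F M ?w"
    using rp_class_eq_iff[OF u w] prod_dst_nonneg[OF u w] by auto
  then show "fint (reduced_product F M) f (map (rp_class F M) as) = rp_class F M ?u"
    by (simp add: reduced_product_def comp_def)
qed


subsection \<open>The reduced product is a structure\<close>

lemma mdst_reduced_prod_dst:
  "a \<in> prod_dom M \<Longrightarrow> b \<in> prod_dom M \<Longrightarrow>
     mdst (reduced_product F M) (rp_class F M a) (rp_class F M b) = prod_dst F M a b"
  by (simp add: mdst_reduced prod_dst_def)

lemma universe_reducedE: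
  assumes "X \<in> universe (reduced_product F M)"
  obtains a where "a \<in> prod_dom M" "X = rp_class F M a"
  using assms by (auto simp: universe_reduced)

lemma tuples_reducedE:
  assumes "Xs \<in> tuples (universe (reduced_product F M)) n"
  obtains as where "\<And>a. a \<in> set as \<Longrightarrow> a \<in> prod_dom M" "length as = n" "Xs = map (rp_class F M) as"
proof -
  have "Xs \<in> lists (rp_class F M ` prod_dom M)"
    using assms by (auto simp: tuples_def universe_reduced)
  then obtain as where "as \<in> lists (prod_dom M)" "Xs = map (rp_class F M) as"
    unfolding lists_image by blast
  then show ?thesis using assms by (intro that[of as]) (auto simp: tuples_def)
qed

lemma metric_reduced:
  "Metric_space (universe (reduced_product F M)) (mdst (reduced_product F M))"
proof
  let ?R = "reduced_product F M"
  have off: "mdst ?R X Y = 0" if "\<not> (X \<in> universe ?R \<and> Y \<in> universe ?R)" for X Y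
    using that by (auto simp: reduced_product_def)
  fix X Y
  show "0 \<le> mdst ?R X Y"
    by (cases "X \<in> universe ?R \<and> Y \<in> universe ?R")
       (auto simp: off mdst_reduced_prod_dst prod_dst_nonneg elim!: universe_reducedE)
  show "mdst ?R X Y = mdst ?R Y X"
    by (cases "X \<in> universe ?R \<and> Y \<in> universe ?R")
       (auto simp: off mdst_reduced_prod_dst prod_dst_commute elim!: universe_reducedE)
next
  let ?R = "reduced_product F M"
  fix X Y assume "X \<in> universe ?R" "Y \<in> universe ?R"
  then show "mdst ?R X Y = 0 \<longleftrightarrow> X = Y"
    by (metis mdst_reduced_prod_dst rp_class_eq_iff universe_reducedE)
next
  let ?R = "reduced_product F M"
  fix X Y Z assume "X \<in> universe ?R" "Y \<in> universe ?R" "Z \<in> universe ?R"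
  then show "mdst ?R X Z \<le> mdst ?R X Y + mdst ?R Y Z"
    by (auto simp: mdst_reduced_prod_dst prod_dst_triangle elim!: universe_reducedE)
qed

lemma coordinate_limit:
  assumes b: "\<And>n. b n \<in> universe (M i)"
  shows "\<exists>c\<in>universe (M i). \<forall>n. (\<forall>j<n. mdst (M i) (b j) (b (Suc j)) < (1/2) ^ j) \<longrightarrow>
           mdst (M i) (b n) c \<le> 2 * (1/2) ^ n"
proof -
  interpret Mi: Metric_space "universe (M i)" "mdst (M i)" by (rule metric_i)
  define G where "G n \<longleftrightarrow> (\<forall>j<n. mdst (M i) (b j) (b (Suc j)) < (1/2) ^ j)" for n :: nat
  define e where "e = rec_nat (b 0) (\<lambda>n y. if G (Suc n) then b (Suc n) else y)"
  have e0: "e 0 = b 0" and eS: "e (Suc n) = (if G (Suc n) then b (Suc n) else e n)" for n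
    by (simp_all add: e_def)
  have e_dom: "e n \<in> universe (M i)" for n
    by (induction n) (auto simp: e0 eS b)
  have e_G: "e n = b n" if "G n" for n
    using that by (cases n) (auto simp: e0 eS)
  have step: "mdst (M i) (e n) (e (Suc n)) \<le> (1/2) ^ n" for n
  proof (cases "G (Suc n)")
    case True
    then have "G n" "mdst (M i) (b n) (b (Suc n)) < (1/2) ^ n" by (auto simp: G_def)
    then show ?thesis using True by (simp add: e_G)
  next
    case False
    then show ?thesis using e_dom by (simp add: eS)
  qed
  have far: "mdst (M i) (e n) (e (n + m)) \<le> 2 * (1/2) ^ n - 2 * (1/2) ^ (n + m)" for n m
  proof (induction m)
    case 0
    then show ?case using e_dom by simp
  next
    case (Suc m)
    have "mdst (M i) (e n) (e (n + Suc m)) \<le>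
            mdst (M i) (e n) (e (n + m)) + mdst (M i) (e (n + m)) (e (Suc (n + m)))"
      using Mi.triangle[OF e_dom e_dom e_dom] by simp
    also have "\<dots> \<le> 2 * (1/2) ^ n - 2 * (1/2) ^ (n + m) + (1/2) ^ (n + m)"
      using Suc step[of "n + m"] by linarith
    finally show ?case by simp
  qed
  have far': "mdst (M i) (e n) (e k) \<le> 2 * (1/2) ^ n" if "n \<le> k" for n k
  proof -
    have "0 \<le> (1/2 :: real) ^ (n + (k - n))" by simp
    then have "mdst (M i) (e n) (e (n + (k - n))) \<le> 2 * (1/2) ^ n"
      using far[of n "k - n"] by linarith
    then show ?thesis using that by simp
  qed
  have "Mi.MCauchy e"
    unfolding Mi.MCauchy_def
  proof (intro conjI allI impI)
    show "range e \<subseteq> universe (M i)" using e_dom by auto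
    fix \<epsilon> :: real assume "\<epsilon> > 0"
    then obtain N where N: "(1/2 :: real) ^ N < \<epsilon> / 4"
      using real_arch_pow_inv[of "\<epsilon> / 4" "1/2"] by auto
    show "\<exists>N. \<forall>n n'. N \<le> n \<longrightarrow> N \<le> n' \<longrightarrow> mdst (M i) (e n) (e n') < \<epsilon>"
    proof (intro exI allI impI)
      fix n n' assume "N \<le> n" "N \<le> n'"
      then have "mdst (M i) (e N) (e n) \<le> 2 * (1/2) ^ N" "mdst (M i) (e N) (e n') \<le> 2 * (1/2) ^ N"
        by (auto intro: far')
      then show "mdst (M i) (e n) (e n') < \<epsilon>"
        using Mi.triangle''[OF e_dom[of n] e_dom[of N] e_dom[of n']] N by linarith
    qed
  qed
  then obtain c where c: "limitin Mi.mtopology e c sequentially"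
    using struct[of i] unfolding L_structure_def Mi.mcomplete_def by blast
  then have c_dom: "c \<in> universe (M i)"
    and lim: "\<And>\<epsilon>. \<epsilon> > 0 \<Longrightarrow> \<exists>N. \<forall>n\<ge>N. mdst (M i) (e n) c < \<epsilon>"
    unfolding Mi.limit_metric_sequentially by blast+
  have "mdst (M i) (e n) c \<le> 2 * (1/2) ^ n" for n
  proof (rule field_le_epsilon)
    fix \<epsilon> :: real assume "\<epsilon> > 0"
    then obtain N where "\<forall>k\<ge>N. mdst (M i) (e k) c < \<epsilon>" using lim by blast
    then have "mdst (M i) (e (max N n)) c < \<epsilon>" by simp
    then show "mdst (M i) (e n) c \<le> 2 * (1/2) ^ n + \<epsilon>"
      using far'[of n "max N n"] Mi.triangle[OF e_dom[of n] e_dom[of "max N n"] c_dom] by simp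
  qed
  then show ?thesis using c_dom e_G unfolding G_def by metis
qed

lemma mcomplete_reduced:
  "Metric_space.mcomplete (universe (reduced_product F M)) (mdst (reduced_product F M))"
proof -
  let ?R = "reduced_product F M"
  interpret R: Metric_space "universe ?R" "mdst ?R" by (rule metric_reduced)
  have "\<exists>X. limitin R.mtopology \<sigma> X sequentially" if \<sigma>: "R.MCauchy \<sigma>" for \<sigma>
  proof -
    have "\<forall>k. \<exists>N. \<forall>n n'. N \<le> n \<longrightarrow> N \<le> n' \<longrightarrow> mdst ?R (\<sigma> n) (\<sigma> n') < (1/2) ^ k"
      using \<sigma> by (auto simp: R.MCauchy_def)
    then obtain N where N: "\<And>k n n'. N k \<le> n \<Longrightarrow> N k \<le> n' \<Longrightarrow> mdst ?R (\<sigma> n) (\<sigma> n') < (1/2) ^ k"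
      by metis
    define r where "r k = k + (\<Sum>j\<le>k. N j)" for k
    have r: "strict_mono r" by (rule strict_monoI_Suc) (simp add: r_def)
    have Nr: "N k \<le> r k" for k
      unfolding r_def by (intro trans_le_add2 member_le_sum) auto
    have close: "mdst ?R (\<sigma> (r k)) (\<sigma> (r (Suc k))) < (1/2) ^ k" for k
      using Nr[of k] strict_mono_less_eq[OF r, of k "Suc k"] by (intro N) auto
    have "\<forall>k. \<exists>a. a \<in> prod_dom M \<and> \<sigma> (r k) = rp_class F M a"
      using \<sigma> unfolding R.MCauchy_def by (meson rangeI subsetD universe_reducedE)
    then obtain b where b: "\<And>k. b k \<in> prod_dom M" "\<And>k. \<sigma> (r k) = rp_class F M (b k)"
      by metis
    have "\<forall>i. \<exists>c\<in>universe (M i). \<forall>n. (\<forall>j<n. mdst (M i) (b j i) (b (Suc j) i) < (1/2) ^ j) \<longrightarrow>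
            mdst (M i) (b n i) c \<le> 2 * (1/2) ^ n"
      using b(1) by (intro allI coordinate_limit) (auto simp: prod_dom_def)
    then obtain c where c: "\<And>i. c i \<in> universe (M i)"
      "\<And>i n. (\<forall>j<n. mdst (M i) (b j i) (b (Suc j) i) < (1/2) ^ j) \<Longrightarrow>
            mdst (M i) (b n i) (c i) \<le> 2 * (1/2) ^ n"
      by metis
    have c_dom: "c \<in> prod_dom M" using c(1) by (simp add: prod_dom_def)
    have bc: "prod_dst F M (b n) c \<le> 2 * (1/2) ^ n" for n
    proof (rule prod_dst_le[OF b(1) c_dom])
      have "eventually (\<lambda>i. \<forall>j\<in>{..<n}. mdst (M i) (b j i) (b (Suc j) i) < (1/2) ^ j) F"
        using close b by (intro eventually_ball_finite ballI prod_dst_less)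
          (auto simp: mdst_reduced_prod_dst)
      then show "eventually (\<lambda>i. mdst (M i) (b n i) (c i) \<le> 2 * (1/2) ^ n) F"
        by (rule eventually_mono) (auto intro: c(2))
    qed
    have "limitin R.mtopology (\<sigma> \<circ> r) (rp_class F M c) sequentially"
      unfolding R.limit_metric_sequentially
    proof (intro conjI allI impI)
      show "rp_class F M c \<in> universe ?R" using c_dom by (simp add: universe_reduced)
      fix \<epsilon> :: real assume "\<epsilon> > 0"
      then obtain K where K: "(1/2 :: real) ^ K < \<epsilon> / 2"
        using real_arch_pow_inv[of "\<epsilon> / 2" "1/2"] by auto
      show "\<exists>K. \<forall>n\<ge>K. (\<sigma> \<circ> r) n \<in> universe ?R \<and> mdst ?R ((\<sigma> \<circ> r) n) (rp_class F M c) < \<epsilon>"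
      proof (intro exI allI impI conjI)
        fix n assume "n \<ge> K"
        show "(\<sigma> \<circ> r) n \<in> universe ?R" using b by (simp add: universe_reduced)
        have "(1/2 :: real) ^ n \<le> (1/2) ^ K" using \<open>n \<ge> K\<close> by (intro power_decreasing) auto
        moreover have "mdst ?R ((\<sigma> \<circ> r) n) (rp_class F M c) = prod_dst F M (b n) c"
          using mdst_reduced_prod_dst[OF b(1) c_dom] b(2) by simp
        ultimately show "mdst ?R ((\<sigma> \<circ> r) n) (rp_class F M c) < \<epsilon>"
          using bc[of n] K by linarith
      qed
    qed
    then show ?thesis using R.MCauchy_convergent_subsequence[OF \<sigma> r] by blast
  qed
  then show ?thesis by (simp add: R.mcomplete_def)
qed

lemma eventually_tuples_close:
  assumes "\<And>a. a \<in> set as \<Longrightarrow> a \<in> prod_dom M" "\<And>b. b \<in> set bs \<Longrightarrow> b \<in> prod_dom M"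
    and "length as = n" "length bs = n"
    and "\<And>k. k < n \<Longrightarrow>
      mdst (reduced_product F M) (map (rp_class F M) as ! k) (map (rp_class F M) bs ! k) < \<delta>"
  shows "eventually (\<lambda>i. \<forall>k<n. mdst (M i) (map (\<lambda>a. a i) as ! k) (map (\<lambda>b. b i) bs ! k) < \<delta>) F"
proof -
  have "eventually (\<lambda>i. \<forall>k\<in>{..<n}. mdst (M i) ((as ! k) i) ((bs ! k) i) < \<delta>) F"
  proof (intro eventually_ball_finite ballI)
    fix k assume "k \<in> {..<n}"
    then have "as ! k \<in> prod_dom M" "bs ! k \<in> prod_dom M"
      using assms(1-4) by auto
    then show "eventually (\<lambda>i. mdst (M i) ((as ! k) i) ((bs ! k) i) < \<delta>) F"
      using assms(3,4) assms(5)[of k] \<open>k \<in> {..<n}\<close>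
      by (intro prod_dst_less) (simp_all add: mdst_reduced_prod_dst)
  qed simp
  then show ?thesis by (rule eventually_mono) (use assms(3,4) in auto)
qed

theorem L_structure_reduced_product: "L_structure L (reduced_product F M)"
  unfolding L_structure_def
proof (intro conjI ballI allI impI metric_reduced mcomplete_reduced)
  let ?R = "reduced_product F M"
  have "\<forall>i. \<exists>x. x \<in> universe (M i)"
    using struct unfolding L_structure_def by blast
  then obtain a where "\<And>i. a i \<in> universe (M i)" by metis
  then show "universe ?R \<noteq> {}" by (auto simp: universe_reduced prod_dom_def)
next
  let ?R = "reduced_product F M"
  fix X Y assume "X \<in> universe ?R" "Y \<in> universe ?R"
  then obtain a b where ab: "a \<in> prod_dom M" "b \<in> prod_dom M"
    and [simp]: "X = rp_class F M a" "Y = rp_class F M b"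
    by (auto elim!: universe_reducedE)
  have "eventually (\<lambda>i. mdst (M i) (a i) (b i) \<le> dbound L) F"
    using prod_dst_bound[OF ab] by (intro always_eventually allI) (auto simp: abs_le_iff)
  then show "mdst ?R X Y \<le> dbound L"
    using prod_dst_le[OF ab] ab by (simp add: mdst_reduced_prod_dst)
next
  let ?R = "reduced_product F M"
  fix f Xs assume f: "f \<in> funs L" and "Xs \<in> tuples (universe ?R) (farity L f)"
  from this(2) obtain as where as: "\<And>a. a \<in> set as \<Longrightarrow> a \<in> prod_dom M"
    "length as = farity L f" "Xs = map (rp_class F M) as" by (metis tuples_reducedE)
  show "fint ?R f Xs \<in> universe ?R"
    using fint_reduced[OF f as(2,1)] as(3) by (simp add: universe_reduced)
next
  let ?R = "reduced_product F M"
  fix f \<epsilon> Xs Ys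
  assume f: "f \<in> funs L" and \<epsilon>: "(0 :: real) < \<epsilon>"
    and "Xs \<in> tuples (universe ?R) (farity L f)" "Ys \<in> tuples (universe ?R) (farity L f)"
    and cl: "\<forall>k<farity L f. mdst ?R (Xs ! k) (Ys ! k) < fmodulus L f \<epsilon>"
  from this(3,4) obtain as bs where as: "\<And>a. a \<in> set as \<Longrightarrow> a \<in> prod_dom M"
    "length as = farity L f" "Xs = map (rp_class F M) as"
    and bs: "\<And>a. a \<in> set bs \<Longrightarrow> a \<in> prod_dom M"
    "length bs = farity L f" "Ys = map (rp_class F M) bs" by (metis tuples_reducedE)
  let ?u = "\<lambda>i. fint (M i) f (map (\<lambda>a. a i) as)" and ?w = "\<lambda>i. fint (M i) f (map (\<lambda>a. a i) bs)"
  have "eventually (\<lambda>i. \<forall>k<farity L f.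
          mdst (M i) (map (\<lambda>a. a i) as ! k) (map (\<lambda>b. b i) bs ! k) < fmodulus L f \<epsilon>) F"
    using cl as(3) bs(3) by (intro eventually_tuples_close[OF as(1) bs(1) as(2) bs(2)]) auto
  then have "eventually (\<lambda>i. mdst (M i) (?u i) (?w i) \<le> \<epsilon>) F"
  proof (rule eventually_mono, goal_cases)
    case (1 i)
    then show ?case
      using struct[of i] f \<epsilon> map_in_tuples(1)[OF as(1), of as i] map_in_tuples(1)[OF bs(1), of bs i]
        as(2) bs(2) unfolding L_structure_def by auto
  qed
  then show "mdst ?R (fint ?R f Xs) (fint ?R f Ys) \<le> \<epsilon>"
    using fint_reduced[OF f as(2,1)] fint_reduced[OF f bs(2,1)] as(3) bs(3)
    by (simp add: mdst_reduced_prod_dst prod_dst_le)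
next
  let ?R = "reduced_product F M"
  fix p Xs assume p: "p \<in> preds L" and "Xs \<in> tuples (universe ?R) (parity L p)"
  from this(2) obtain as where as: "\<And>a. a \<in> set as \<Longrightarrow> a \<in> prod_dom M"
    "length as = parity L p" "Xs = map (rp_class F M) as" by (metis tuples_reducedE)
  let ?u = "\<lambda>i. pint (M i) p (map (\<lambda>a. a i) as)"
  have bd: "\<bar>?u i\<bar> \<le> pbound L p" for i
    using struct[of i] p map_in_tuples(1)[OF as(1), of as i] as(2) by (auto simp: L_structure_def)
  have "rlimsup F ?u \<le> pbound L p"
    using bd by (intro rlimsup_le[OF proper bd] always_eventually allI) (auto simp: abs_le_iff)
  moreover have "- pbound L p \<le> rlimsup F ?u"
  proof (rule ccontr)
    assume "\<not> - pbound L p \<le> rlimsup F ?u"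
    then have "eventually (\<lambda>i. ?u i < - pbound L p) F"
      by (intro eventually_rlimsup_less[OF proper bd]) simp
    then obtain i where "?u i < - pbound L p"
      using eventually_happens'[OF proper] by blast
    then show False using bd[of i] by linarith
  qed
  ultimately show "\<bar>pint ?R p Xs\<bar> \<le> pbound L p"
    using pint_reduced[OF p as(2,1)] as(3) by (simp add: abs_le_iff)
next
  let ?R = "reduced_product F M"
  fix p \<epsilon> Xs Ys
  assume p: "p \<in> preds L" and \<epsilon>: "(0 :: real) < \<epsilon>"
    and "Xs \<in> tuples (universe ?R) (parity L p)" "Ys \<in> tuples (universe ?R) (parity L p)"
    and cl: "\<forall>k<parity L p. mdst ?R (Xs ! k) (Ys ! k) < pmodulus L p \<epsilon>"
  from this(3,4) obtain as bs where as: "\<And>a. a \<in> set as \<Longrightarrow> a \<in> prod_dom M"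
    "length as = parity L p" "Xs = map (rp_class F M) as"
    and bs: "\<And>a. a \<in> set bs \<Longrightarrow> a \<in> prod_dom M"
    "length bs = parity L p" "Ys = map (rp_class F M) bs" by (metis tuples_reducedE)
  let ?u = "\<lambda>i. pint (M i) p (map (\<lambda>a. a i) as)" and ?w = "\<lambda>i. pint (M i) p (map (\<lambda>a. a i) bs)"
  have tup: "map (\<lambda>a. a i) as \<in> tuples (universe (M i)) (parity L p)"
    "map (\<lambda>a. a i) bs \<in> tuples (universe (M i)) (parity L p)" for i
    using map_in_tuples(1)[OF as(1), of as i] map_in_tuples(1)[OF bs(1), of bs i] as(2) bs(2) by auto
  have bd: "\<bar>?u i\<bar> \<le> pbound L p" "\<bar>?w i\<bar> \<le> pbound L p" for i
    using struct[of i] p tup[of i] by (auto simp: L_structure_def)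
  have "eventually (\<lambda>i. \<forall>k<parity L p.
          mdst (M i) (map (\<lambda>a. a i) as ! k) (map (\<lambda>b. b i) bs ! k) < pmodulus L p \<epsilon>) F"
    using cl as(3) bs(3) by (intro eventually_tuples_close[OF as(1) bs(1) as(2) bs(2)]) auto
  then have ev: "eventually (\<lambda>i. \<bar>?u i - ?w i\<bar> \<le> \<epsilon>) F"
  proof (rule eventually_mono, goal_cases)
    case (1 i)
    then show ?case
      using struct[of i] p \<epsilon> tup[of i] unfolding L_structure_def by auto
  qed
  have "rlimsup F ?u \<le> rlimsup F ?w + \<epsilon>"
    by (rule rlimsup_le_add[OF proper bd(1) bd(2)], rule eventually_mono[OF ev]) linarith
  moreover have "rlimsup F ?w \<le> rlimsup F ?u + \<epsilon>"
    by (rule rlimsup_le_add[OF proper bd(2) bd(1)], rule eventually_mono[OF ev]) linarith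
  ultimately show "\<bar>pint ?R p Xs - pint ?R p Ys\<bar> \<le> \<epsilon>"
    using pint_reduced[OF p as(2,1)] pint_reduced[OF p bs(2,1)] as(3) bs(3) by (simp add: abs_le_iff)
qed

end

end

(* Suprema and infima commute with the limit superior because near-optimal points can be chosen
   coordinatewise, and nondecreasing continuous connectives and max preserve it; this settles all
   clauses but the last. There D turns the limsup of phi into the liminf of D phi, and
   limsup min(D phi, Delta, psi) dominates min(liminf D phi, Delta, limsup psi), so sup_x of the
   minimum is preserved. For the converse, if inf_x phi < t < Delta in the reduced product,
   a point witnessing this may be altered on the coordinates where the minimum exceeds t somewhere:
   D phi stays at least t eventually, because phi < Delta forces D phi >= Delta. *)
theory Submission
  imports Defs
begin

section \<open>Limits superior along a proper filter, \<open>max\<close>, and monotone continuous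
  maps\<close>

section \<open>Limits superior\<close>

text \<open>Infima and suprema of reals behave well only for bounded families; this bounds the
  limits superior that are later ranged over the product. A bound violated eventually is violated at
  some index, as the filter is proper.\<close>

lemma abs_rlimsup_le:
  assumes "F \<noteq> bot" "\<And>i. \<bar>u i\<bar> \<le> B"
  shows "\<bar>rlimsup F u\<bar> \<le> B"
proof -
  have "rlimsup F u \<le> B"
    using assms by (intro rlimsup_le[where B = B] always_eventually) (auto simp: abs_le_iff)
  moreover have "- B \<le> rlimsup F u"
  proof (rule ccontr)
    assume "\<not> - B \<le> rlimsup F u"
    then have "eventually (\<lambda>i. u i < - B) F"
      using assms by (intro eventually_rlimsup_less[where B = B]) auto
    then obtain i where "u i < - B"
      using eventually_happens'[OF assms(1)] by blast
    then show False using assms(2)[of i] by linarith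
  qed
  ultimately show ?thesis by linarith
qed

lemma rlimsup_mono:
  assumes "F \<noteq> bot" "\<And>i. \<bar>u i\<bar> \<le> B" "\<And>i. \<bar>w i\<bar> \<le> B'" "\<And>i. u i \<le> w i"
  shows "rlimsup F u \<le> rlimsup F w"
  using rlimsup_le_add[of F u B w B' 0] assms by simp

text \<open>Two eventual estimates hold together on one member of the filter. The analogue for
  \<open>min\<close> fails, since two families can be large on disjoint index sets; hence the last
  Palyutin clause needs an argument of its own.\<close>

lemma rlimsup_max:
  assumes F: "F \<noteq> bot" and u: "\<And>i. \<bar>u i\<bar> \<le> B" and w: "\<And>i. \<bar>w i\<bar> \<le> B'"
  shows "rlimsup F (\<lambda>i. max (u i) (w i)) = max (rlimsup F u) (rlimsup F w)"
proof (rule antisym)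
  have bd: "\<bar>max (u i) (w i)\<bar> \<le> max B B'" for i
    using u[of i] w[of i] by linarith
  show "rlimsup F (\<lambda>i. max (u i) (w i)) \<le> max (rlimsup F u) (rlimsup F w)"
  proof (rule field_le_epsilon)
    fix \<epsilon> :: real assume "\<epsilon> > 0"
    then have "eventually (\<lambda>i. u i < rlimsup F u + \<epsilon>) F" "eventually (\<lambda>i. w i < rlimsup F w + \<epsilon>) F"
      by (auto intro!: eventually_rlimsup_less[OF F u] eventually_rlimsup_less[OF F w])
    then have "eventually (\<lambda>i. max (u i) (w i) \<le> max (rlimsup F u) (rlimsup F w) + \<epsilon>) F"
      by eventually_elim linarith
    then show "rlimsup F (\<lambda>i. max (u i) (w i)) \<le> max (rlimsup F u) (rlimsup F w) + \<epsilon>"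
      by (rule rlimsup_le[OF F bd])
  qed
  show "max (rlimsup F u) (rlimsup F w) \<le> rlimsup F (\<lambda>i. max (u i) (w i))"
    by (intro max.boundedI rlimsup_mono[OF F u bd] rlimsup_mono[OF F w bd]) auto
qed

lemma rlimsup_continuous_mono:
  fixes C :: "real \<Rightarrow> real"
  assumes F: "F \<noteq> bot" and u: "\<And>i. \<bar>u i\<bar> \<le> B" and C: "continuous_on UNIV C" "mono C"
  shows "rlimsup F (\<lambda>i. C (u i)) = C (rlimsup F u)"
proof -
  let ?l = "rlimsup F u"
  \<comment> \<open>By monotonicity, values on the interval from \<open>- B\<close> to
    \<open>B\<close> lie between \<open>C (- B)\<close> and \<open>C B\<close>.\<close>
  have bd: "\<bar>C (u i)\<bar> \<le> max \<bar>C B\<bar> \<bar>C (- B)\<bar>" for i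
    using monoD[OF C(2), of "u i" B] monoD[OF C(2), of "- B" "u i"] u[of i] by linarith
  have "isCont C ?l"
    using C(1) by (simp add: continuous_on_eq_continuous_at)
  then have near: "\<exists>\<delta>>0. \<forall>x. \<bar>x - ?l\<bar> < \<delta> \<longrightarrow> \<bar>C x - C ?l\<bar> < \<epsilon>" if "\<epsilon> > 0" for \<epsilon>
    using that by (auto simp: continuous_at_eps_delta dist_real_def)
  show ?thesis
  proof (rule antisym; rule field_le_epsilon)
    fix \<epsilon> :: real assume "\<epsilon> > 0"
    then obtain \<delta> where \<delta>: "\<delta> > 0" "\<And>x. \<bar>x - ?l\<bar> < \<delta> \<Longrightarrow> \<bar>C x - C ?l\<bar> < \<epsilon>"
      using near by blast
    have "eventually (\<lambda>i. u i < ?l + \<delta> / 2) F"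
      using \<delta>(1) by (intro eventually_rlimsup_less[OF F u]) simp
    then have "eventually (\<lambda>i. C (u i) \<le> C ?l + \<epsilon>) F"
    proof eventually_elim
      case (elim i)
      then have "C (u i) \<le> C (?l + \<delta> / 2)" by (intro monoD[OF C(2)]) simp
      then show ?case using \<delta>(2)[of "?l + \<delta> / 2"] \<delta>(1) by simp
    qed
    then show "rlimsup F (\<lambda>i. C (u i)) \<le> C ?l + \<epsilon>"
      by (rule rlimsup_le[OF F bd])
    show "C ?l \<le> rlimsup F (\<lambda>i. C (u i)) + \<epsilon>"
    proof (rule ccontr)
      assume "\<not> ?thesis"
      then have "eventually (\<lambda>i. C (u i) < C ?l - \<epsilon>) F"
        by (intro eventually_rlimsup_less[OF F bd]) simp
      \<comment> \<open>Were \<open>u i\<close> above \<open>?l - \<delta> / 2\<close>, monotonicity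
        would keep \<open>C (u i)\<close> above \<open>C ?l - \<epsilon>\<close>. So
        \<open>u\<close> is eventually too small for its limit superior.\<close>
      then have "eventually (\<lambda>i. u i \<le> ?l - \<delta> / 2) F"
      proof eventually_elim
        case (elim i)
        show ?case
        proof (rule ccontr)
          assume "\<not> ?thesis"
          then have "C (?l - \<delta> / 2) \<le> C (u i)" by (intro monoD[OF C(2)]) simp
          then show False using \<delta>(2)[of "?l - \<delta> / 2"] \<delta>(1) elim by simp
        qed
      qed
      then have "?l \<le> ?l - \<delta> / 2" by (rule rlimsup_le[OF F u])
      then show False using \<delta>(1) by simp
    qed
  qed
qed

text \<open>The previous lemma, applied to the nondecreasing map \<open>- D\<close>, makes
  \<open>D (rlimsup F u)\<close> the limit inferior of \<open>D (u i)\<close>. The two parts express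
  this through eventual estimates.\<close>

lemma antimono_rlimsup:
  fixes D :: "real \<Rightarrow> real"
  assumes F: "F \<noteq> bot" and u: "\<And>i. \<bar>u i\<bar> \<le> B" and D: "continuous_on UNIV D" "antimono D"
  shows "t < D (rlimsup F u) \<Longrightarrow> eventually (\<lambda>i. t < D (u i)) F"
    and "eventually (\<lambda>i. t \<le> D (u i)) F \<Longrightarrow> t \<le> D (rlimsup F u)"
proof -
  have C: "continuous_on UNIV (\<lambda>x. - D x)" "mono (\<lambda>x. - D x)"
    using D(1) by (rule continuous_on_minus, intro monoI le_imp_neg_le antimonoD[OF D(2)])
  have lim: "rlimsup F (\<lambda>i. - D (u i)) = - D (rlimsup F u)"
    by (rule rlimsup_continuous_mono[OF F u C])
  have bd: "\<bar>- D (u i)\<bar> \<le> max \<bar>D B\<bar> \<bar>D (- B)\<bar>" for i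
    using antimonoD[OF D(2), of "u i" B] antimonoD[OF D(2), of "- B" "u i"] u[of i] by linarith
  show "eventually (\<lambda>i. t < D (u i)) F" if "t < D (rlimsup F u)"
    using eventually_rlimsup_less[where u = "\<lambda>i. - D (u i)", OF F bd, of "- t"] that lim by simp
  show "t \<le> D (rlimsup F u)" if "eventually (\<lambda>i. t \<le> D (u i)) F"
    using rlimsup_le[where u = "\<lambda>i. - D (u i)", OF F bd, of "- t"] that lim by simp
qed


section \<open>Compactness bounds valid in all structures of the signature at once\<close>

section \<open>Uniform bounds on formulas\<close>

text \<open>A continuous map is bounded on a compact cube. Connectives are tested on real sequences,
  so the cube has infinitely many factors and is compact by Tychonoff's theorem.\<close>

lemma connective_bounded:
  assumes "connective n C"
  shows "\<exists>B'. \<forall>rs. length rs = n \<and> (\<forall>r\<in>set rs. \<bar>r\<bar> \<le> B) \<longrightarrow> \<bar>C rs\<bar> \<le> B'"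
proof -
  \<comment> \<open>The absolute value keeps 0 in the cube even for negative \<open>B\<close>, which
    the empty list admits; 0 is the padding value beyond position \<open>n\<close>.\<close>
  let ?K = "Pi UNIV (\<lambda>_ :: nat. {- \<bar>B\<bar>..\<bar>B\<bar>})"
  have "compactin (product_topology (\<lambda>_ :: nat. euclidean) UNIV) (PiE UNIV (\<lambda>_ :: nat. {- \<bar>B\<bar>..\<bar>B\<bar>}))"
    unfolding compactin_PiE by simp
  then have "compact ?K"
    by (simp add: euclidean_product_topology PiE_UNIV_domain)
  then have "bounded ((\<lambda>x. C (map x [0..<n])) ` ?K)"
    using assms unfolding connective_def
    by (intro compact_imp_bounded compact_continuous_image) (auto elim: continuous_on_subset)
  then obtain B' where B': "\<And>x. x \<in> ?K \<Longrightarrow> \<bar>C (map x [0..<n])\<bar> \<le> B'"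
    unfolding bounded_iff by auto
  have "\<bar>C rs\<bar> \<le> B'" if rs: "length rs = n" "\<forall>r\<in>set rs. \<bar>r\<bar> \<le> B" for rs
  proof -
    let ?x = "\<lambda>k. if k < n then rs ! k else 0"
    have "\<bar>?x k\<bar> \<le> \<bar>B\<bar>" for k
    proof (cases "k < n")
      case True
      then have "\<bar>rs ! k\<bar> \<le> B" using rs by simp
      then show ?thesis using True by simp
    qed simp
    then have "?x \<in> ?K" unfolding abs_le_iff by (auto simp: minus_le_iff)
    moreover have "map ?x [0..<n] = rs" using rs(1) by (auto intro: nth_equalityI)
    ultimately show ?thesis using B'[of ?x] by simp
  qed
  then show ?thesis by blast
qed

lemma trm_val_in_universe:
  assumes "L_structure L N" "wf_trm L t" "\<And>v. v \<in> vars_trm t \<Longrightarrow> s v \<in> universe N"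
  shows "trm_val N s t \<in> universe N"
  using assms(2,3)
proof (induction t)
  case (Var v)
  then show ?case by simp
next
  case (Fun f ts)
  then have "map (trm_val N s) ts \<in> tuples (universe N) (farity L f)"
    by (auto simp: tuples_def)
  then show ?case using assms(1) Fun.prems(1) by (simp add: L_structure_def)
qed

text \<open>The bound is chosen before the structure and the assignment, so one constant serves all
  factors of a product.\<close>

lemma fm_val_bounded:
  fixes L :: "('f, 'p) signature"
  assumes "wf_fm L \<phi>"
  shows "\<exists>B. \<forall>(N :: ('f, 'p, 'a) mstruct) s. L_structure L N \<longrightarrow>
           (\<forall>v\<in>free_vars \<phi>. s v \<in> universe N) \<longrightarrow> \<bar>fm_val N s \<phi>\<bar> \<le> B"
  using assms
proof (induction \<phi>)
  case (Pred p ts)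
  have "\<bar>fm_val N s (Pred p ts)\<bar> \<le> pbound L p"
    if "L_structure L N" "\<forall>v\<in>free_vars (Pred p ts :: ('f, 'p) fm). s v \<in> universe N"
    for N :: "('f, 'p, 'a) mstruct" and s
  proof -
    have "map (trm_val N s) ts \<in> tuples (universe N) (parity L p)"
      using Pred that by (auto simp: tuples_def intro!: trm_val_in_universe[OF that(1)])
    then show ?thesis using Pred that(1) by (simp add: L_structure_def)
  qed
  then show ?case by blast
next
  case (Dist t u)
  have "\<bar>fm_val N s (Dist t u)\<bar> \<le> dbound L"
    if "L_structure L N" "\<forall>v\<in>free_vars (Dist t u :: ('f, 'p) fm). s v \<in> universe N"
    for N :: "('f, 'p, 'a) mstruct" and s
  proof -
    have "trm_val N s t \<in> universe N" "trm_val N s u \<in> universe N"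
      using Dist that by (auto intro!: trm_val_in_universe[OF that(1)])
    moreover have "Metric_space (universe N) (mdst N)" using that(1) by (simp add: L_structure_def)
    ultimately show ?thesis
      using that(1) Metric_space.nonneg[of "universe N" "mdst N"] by (simp add: L_structure_def)
  qed
  then show ?case by blast
next
  case (Conn C \<phi>s)
  have "\<forall>\<phi>\<in>set \<phi>s. \<exists>B. \<forall>(N :: ('f, 'p, 'a) mstruct) s. L_structure L N \<longrightarrow>
          (\<forall>v\<in>free_vars \<phi>. s v \<in> universe N) \<longrightarrow> \<bar>fm_val N s \<phi>\<bar> \<le> B"
    using Conn by simp
  then obtain b where b: "\<And>\<phi> (N :: ('f, 'p, 'a) mstruct) s. \<phi> \<in> set \<phi>s \<Longrightarrow> L_structure L N \<Longrightarrow>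
          (\<forall>v\<in>free_vars \<phi>. s v \<in> universe N) \<Longrightarrow> \<bar>fm_val N s \<phi>\<bar> \<le> b \<phi>"
    unfolding bchoice_iff by blast
  \<comment> \<open>The sum of absolute values dominates each \<open>b \<phi>\<close> whatever its
    sign, so a single cube contains all arguments of \<open>C\<close>.\<close>
  have b_le: "b \<phi> \<le> (\<Sum>\<psi>\<in>set \<phi>s. \<bar>b \<psi>\<bar>)" if "\<phi> \<in> set \<phi>s" for \<phi>
    using member_le_sum[of \<phi> "set \<phi>s" "\<lambda>\<psi>. \<bar>b \<psi>\<bar>"] that by simp
  obtain B' where B': "\<And>rs. length rs = length \<phi>s \<Longrightarrow> (\<forall>r\<in>set rs. \<bar>r\<bar> \<le> (\<Sum>\<psi>\<in>set \<phi>s. \<bar>b \<psi>\<bar>)) \<Longrightarrow>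
      \<bar>C rs\<bar> \<le> B'"
    using connective_bounded[of "length \<phi>s" C "\<Sum>\<psi>\<in>set \<phi>s. \<bar>b \<psi>\<bar>"] Conn.prems by auto
  have "\<bar>fm_val N s (Conn C \<phi>s)\<bar> \<le> B'"
    if "L_structure L N" "\<forall>v\<in>free_vars (Conn C \<phi>s). s v \<in> universe N"
    for N :: "('f, 'p, 'a) mstruct" and s
  proof -
    have "\<bar>fm_val N s \<phi>\<bar> \<le> (\<Sum>\<psi>\<in>set \<phi>s. \<bar>b \<psi>\<bar>)" if "\<phi> \<in> set \<phi>s" for \<phi>
      using \<open>L_structure L N\<close> \<open>\<forall>v\<in>free_vars (Conn C \<phi>s). _\<close> that
      by (intro order_trans[OF b b_le]) auto
    then show ?thesis by (auto intro!: B')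
  qed
  then show ?case by blast
next
  case (Sup_fm v \<phi>)
  then obtain B where B: "\<And>(N :: ('f, 'p, 'a) mstruct) s. L_structure L N \<Longrightarrow>
      (\<forall>v\<in>free_vars \<phi>. s v \<in> universe N) \<Longrightarrow> \<bar>fm_val N s \<phi>\<bar> \<le> B" by auto
  have "\<bar>fm_val N s (Sup_fm v \<phi>)\<bar> \<le> B"
    if "L_structure L N" "\<forall>w\<in>free_vars (Sup_fm v \<phi>). s w \<in> universe N"
    for N :: "('f, 'p, 'a) mstruct" and s
  proof -
    have "\<bar>fm_val N (s(v := c)) \<phi>\<bar> \<le> B" if "c \<in> universe N" for c
      using \<open>L_structure L N\<close> \<open>\<forall>w\<in>free_vars (Sup_fm v \<phi>). _\<close> that by (intro B) auto
    then show ?thesis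
      using that(1) by (auto simp: L_structure_def intro!: cSup_abs_le)
  qed
  then show ?case by blast
next
  case (Inf_fm v \<phi>)
  then obtain B where B: "\<And>(N :: ('f, 'p, 'a) mstruct) s. L_structure L N \<Longrightarrow>
      (\<forall>v\<in>free_vars \<phi>. s v \<in> universe N) \<Longrightarrow> \<bar>fm_val N s \<phi>\<bar> \<le> B" by auto
  have "\<bar>fm_val N s (Inf_fm v \<phi>)\<bar> \<le> B"
    if "L_structure L N" "\<forall>w\<in>free_vars (Inf_fm v \<phi>). s w \<in> universe N"
    for N :: "('f, 'p, 'a) mstruct" and s
  proof -
    have "\<bar>fm_val N (s(v := c)) \<phi>\<bar> \<le> B" if "c \<in> universe N" for c
      using \<open>L_structure L N\<close> \<open>\<forall>w\<in>free_vars (Inf_fm v \<phi>). _\<close> that by (intro B) auto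
    then show ?thesis
      using that(1) by (auto simp: L_structure_def intro!: cInf_abs_ge)
  qed
  then show ?case by blast
qed


section \<open>Interchange of infima and suprema over the product with limits superior\<close>

section \<open>Quantifiers and reduced products\<close>

context structure_family
begin

lemma universe_nonempty: "universe (M i) \<noteq> {}"
  using struct[of i] by (simp add: L_structure_def)

lemma prod_dom_nonempty: "prod_dom M \<noteq> {}"
proof -
  have "(\<lambda>i. SOME c. c \<in> universe (M i)) \<in> prod_dom M"
    using universe_nonempty by (auto simp: prod_dom_def some_in_eq)
  then show ?thesis by blast
qed

text \<open>Think of \<open>g i c\<close> as the value of a formula in factor \<open>i\<close> with
  \<open>c\<close> for the quantified variable. Points within \<epsilon> of the infimum in each
  coordinate assemble into one element of the product; the converse is coordinatewise
  monotonicity.\<close>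

lemma INF_rlimsup:
  assumes g: "\<And>i c. c \<in> universe (M i) \<Longrightarrow> \<bar>g i c\<bar> \<le> B"
  shows "(INF b\<in>prod_dom M. rlimsup F (\<lambda>i. g i (b i))) = rlimsup F (\<lambda>i. INF c\<in>universe (M i). g i c)"
    (is "?l = rlimsup F ?w")
proof (rule antisym)
  have w: "\<bar>?w i\<bar> \<le> B" for i
    using universe_nonempty g by (intro cInf_abs_ge) auto
  have gb: "\<bar>g i (b i)\<bar> \<le> B" if "b \<in> prod_dom M" for b i
    using that g by (auto simp: prod_dom_def)
  have below: "bdd_below (g i ` universe (M i))" for i
    using g[of _ i] by (intro bdd_belowI[of _ "- B"]) (auto simp: abs_le_iff minus_le_iff)
  have lim_bd: "\<bar>rlimsup F (\<lambda>i. g i (b i))\<bar> \<le> B" if "b \<in> prod_dom M" for b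
    by (rule abs_rlimsup_le[OF proper gb[OF that]])
  have bdd: "bdd_below ((\<lambda>b. rlimsup F (\<lambda>i. g i (b i))) ` prod_dom M)"
    using lim_bd by (intro bdd_belowI2[of _ "- B"]) (auto simp: abs_le_iff minus_le_iff)
  show "?l \<le> rlimsup F ?w"
  proof (rule field_le_epsilon)
    fix \<epsilon> :: real assume "\<epsilon> > 0"
    have "\<exists>c\<in>universe (M i). g i c < ?w i + \<epsilon>" for i
      using \<open>\<epsilon> > 0\<close> cINF_less_iff[OF universe_nonempty below, of i "?w i + \<epsilon>"] by simp
    then obtain b where b: "\<And>i. b i \<in> universe (M i)" "\<And>i. g i (b i) < ?w i + \<epsilon>" by metis
    then have b_dom: "b \<in> prod_dom M" by (simp add: prod_dom_def)
    have "?l \<le> rlimsup F (\<lambda>i. g i (b i))" by (rule cINF_lower[OF bdd b_dom])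
    also have "\<dots> \<le> rlimsup F ?w + \<epsilon>"
      using b(2) by (intro rlimsup_le_add[OF proper gb[OF b_dom] w] always_eventually allI less_imp_le)
    finally show "?l \<le> rlimsup F ?w + \<epsilon>" .
  qed
  show "rlimsup F ?w \<le> ?l"
  proof (rule cINF_greatest[OF prod_dom_nonempty])
    fix b assume b: "b \<in> prod_dom M"
    then show "rlimsup F ?w \<le> rlimsup F (\<lambda>i. g i (b i))"
      by (intro rlimsup_mono[OF proper w gb] cINF_lower[OF below]) (auto simp: prod_dom_def)
  qed
qed

text \<open>Dual to the infimum, with the monotonicity and the \<epsilon>-optimal direction
  exchanged. Near-maximal points are chosen at every index, so one \<open>b\<close> works for all
  sets of the filter.\<close>

lemma SUP_rlimsup:
  assumes g: "\<And>i c. c \<in> universe (M i) \<Longrightarrow> \<bar>g i c\<bar> \<le> B"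
  shows "(SUP b\<in>prod_dom M. rlimsup F (\<lambda>i. g i (b i))) = rlimsup F (\<lambda>i. SUP c\<in>universe (M i). g i c)"
    (is "?l = rlimsup F ?w")
proof (rule antisym)
  have w: "\<bar>?w i\<bar> \<le> B" for i
    using universe_nonempty g by (intro cSup_abs_le) auto
  have gb: "\<bar>g i (b i)\<bar> \<le> B" if "b \<in> prod_dom M" for b i
    using that g by (auto simp: prod_dom_def)
  have above: "bdd_above (g i ` universe (M i))" for i
    using g[of _ i] by (intro bdd_aboveI[of _ B]) (auto simp: abs_le_iff)
  have lim_bd: "\<bar>rlimsup F (\<lambda>i. g i (b i))\<bar> \<le> B" if "b \<in> prod_dom M" for b
    by (rule abs_rlimsup_le[OF proper gb[OF that]])
  have bdd: "bdd_above ((\<lambda>b. rlimsup F (\<lambda>i. g i (b i))) ` prod_dom M)"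
    using lim_bd by (intro bdd_aboveI2[of _ _ B]) (auto simp: abs_le_iff)
  show "?l \<le> rlimsup F ?w"
  proof (rule cSUP_least[OF prod_dom_nonempty])
    fix b assume b: "b \<in> prod_dom M"
    then show "rlimsup F (\<lambda>i. g i (b i)) \<le> rlimsup F ?w"
      by (intro rlimsup_mono[OF proper gb w] cSUP_upper[OF _ above]) (auto simp: prod_dom_def)
  qed
  show "rlimsup F ?w \<le> ?l"
  proof (rule field_le_epsilon)
    fix \<epsilon> :: real assume "\<epsilon> > 0"
    have "\<exists>c\<in>universe (M i). ?w i - \<epsilon> < g i c" for i
      using \<open>\<epsilon> > 0\<close> less_cSUP_iff[OF universe_nonempty above, of "?w i - \<epsilon>" i] by simp
    then obtain b where b: "\<And>i. b i \<in> universe (M i)" "\<And>i. ?w i - \<epsilon> < g i (b i)" by metis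
    then have b_dom: "b \<in> prod_dom M" by (simp add: prod_dom_def)
    have "?w i \<le> g i (b i) + \<epsilon>" for i using b(2)[of i] by linarith
    then have "rlimsup F ?w \<le> rlimsup F (\<lambda>i. g i (b i)) + \<epsilon>"
      by (intro rlimsup_le_add[OF proper w gb[OF b_dom]] always_eventually allI)
    also have "\<dots> \<le> ?l + \<epsilon>" using cSUP_upper[OF b_dom bdd] by simp
    finally show "rlimsup F ?w \<le> ?l + \<epsilon>" .
  qed
qed

text \<open>The left supremum alone can be too small: \<open>D\<close> of a limit superior is a
  limit inferior, so a good choice on part of the indices is spoiled if \<open>D (g i c)\<close>
  stays below \<Delta> for all \<open>c\<close> elsewhere. But then \<open>g i c\<close> exceeds
  \<Delta> there by the fixed point, and the infimum makes up for it.\<close>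

lemma relative_SUP_rlimsup:
  fixes D :: "real \<Rightarrow> real"
  assumes g: "\<And>i c. c \<in> universe (M i) \<Longrightarrow> \<bar>g i c\<bar> \<le> B"
    and h: "\<And>i c. c \<in> universe (M i) \<Longrightarrow> \<bar>h i c\<bar> \<le> B'"
    and D: "continuous_on UNIV D" "antimono D" "D \<Delta> = \<Delta>"
  shows "max (INF b\<in>prod_dom M. rlimsup F (\<lambda>i. g i (b i)))
             (SUP b\<in>prod_dom M. min (D (rlimsup F (\<lambda>i. g i (b i))))
                                     (min \<Delta> (rlimsup F (\<lambda>i. h i (b i))))) =
         rlimsup F (\<lambda>i. max (INF c\<in>universe (M i). g i c)
                            (SUP c\<in>universe (M i). min (D (g i c)) (min \<Delta> (h i c))))"
    (is "max ?I ?S = rlimsup F (\<lambda>i. max (?m i) (?s i))")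
proof (rule antisym)
  have gb: "\<bar>g i (b i)\<bar> \<le> B" and hb: "\<bar>h i (b i)\<bar> \<le> B'" if "b \<in> prod_dom M" for b i
    using that g h by (auto simp: prod_dom_def)
  have m: "\<bar>?m i\<bar> \<le> B" for i
    using universe_nonempty g by (intro cInf_abs_ge) auto
  have s_le: "?s i \<le> \<Delta>" for i
    using universe_nonempty by (intro cSUP_least) auto
  \<comment> \<open>The lower bound comes from \<open>?m\<close>, the upper one from
    \<open>?m\<close> together with the cap \<Delta> on \<open>?s\<close>.\<close>
  have theta: "\<bar>max (?m i) (?s i)\<bar> \<le> max B \<bar>\<Delta>\<bar>" for i
    using m[of i] s_le[of i] by linarith
  have above: "bdd_above ((\<lambda>c. min (D (g i c)) (min \<Delta> (h i c))) ` universe (M i))" for i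
    by (intro bdd_aboveI[of _ \<Delta>]) auto
  have I: "?I = rlimsup F ?m" by (rule INF_rlimsup[OF g])
  show "max ?I ?S \<le> rlimsup F (\<lambda>i. max (?m i) (?s i))"
  proof (rule max.boundedI)
    show "?I \<le> rlimsup F (\<lambda>i. max (?m i) (?s i))"
      unfolding I by (intro rlimsup_mono[OF proper m theta]) auto
    show "?S \<le> rlimsup F (\<lambda>i. max (?m i) (?s i))"
    proof (rule cSUP_least[OF prod_dom_nonempty], rule ccontr)
      fix b assume b: "b \<in> prod_dom M"
      assume "\<not> min (D (rlimsup F (\<lambda>i. g i (b i)))) (min \<Delta> (rlimsup F (\<lambda>i. h i (b i))))
                  \<le> rlimsup F (\<lambda>i. max (?m i) (?s i))"
      then obtain t where "rlimsup F (\<lambda>i. max (?m i) (?s i)) < t"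
        "t < min (D (rlimsup F (\<lambda>i. g i (b i)))) (min \<Delta> (rlimsup F (\<lambda>i. h i (b i))))"
        unfolding not_le by (blast dest: dense)
      then have t: "rlimsup F (\<lambda>i. max (?m i) (?s i)) < t" "t < D (rlimsup F (\<lambda>i. g i (b i)))"
        "t < \<Delta>" "t < rlimsup F (\<lambda>i. h i (b i))"
        unfolding min_less_iff_conj by blast+
      have "eventually (\<lambda>i. max (?m i) (?s i) < t) F"
        by (rule eventually_rlimsup_less[OF proper theta t(1)])
      moreover have "eventually (\<lambda>i. t < D (g i (b i))) F"
        by (rule antimono_rlimsup(1)[OF proper gb[OF b] D(1,2) t(2)])
      \<comment> \<open>At such \<open>i\<close> the minimum at \<open>b i\<close> is below
        \<open>t\<close> while \<Delta> and the entry from \<open>D\<close> exceed \<open>t\<close>,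
        so the entry from \<open>h\<close> is the small one.\<close>
      ultimately have "eventually (\<lambda>i. h i (b i) \<le> t) F"
      proof eventually_elim
        case (elim i)
        have "min (D (g i (b i))) (min \<Delta> (h i (b i))) \<le> ?s i"
          using b by (intro cSUP_upper[OF _ above]) (auto simp: prod_dom_def)
        then show ?case using elim t(3) by linarith
      qed
      then have "rlimsup F (\<lambda>i. h i (b i)) \<le> t" by (rule rlimsup_le[OF proper hb[OF b]])
      then show False using t(4) by simp
    qed
  qed
  show "rlimsup F (\<lambda>i. max (?m i) (?s i)) \<le> max ?I ?S"
  proof (rule dense_ge)
    fix t assume t: "max ?I ?S < t"
    have m_ev: "eventually (\<lambda>i. ?m i < t) F"
      using t I by (intro eventually_rlimsup_less[OF proper m]) simp
    \<comment> \<open>The cap \<Delta> settles the case \<Delta> \<le> \<open>t\<close>. Otherwise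
      \<open>t\<close> < \<Delta>, and the fixed point can be used.\<close>
    have "eventually (\<lambda>i. ?s i \<le> t) F"
    proof (cases "\<Delta> \<le> t")
      case True
      then show ?thesis using s_le by (intro always_eventually allI) (rule order_trans)
    next
      case False
      have lim_bd: "\<bar>rlimsup F (\<lambda>i. g i (b i))\<bar> \<le> B" if "b \<in> prod_dom M" for b
        by (rule abs_rlimsup_le[OF proper gb[OF that]])
      have bdd: "bdd_below ((\<lambda>b. rlimsup F (\<lambda>i. g i (b i))) ` prod_dom M)"
        using lim_bd by (intro bdd_belowI2[of _ "- B"]) (auto simp: abs_le_iff minus_le_iff)
      obtain b0 where b0: "b0 \<in> prod_dom M" "rlimsup F (\<lambda>i. g i (b0 i)) < t"
        using t cINF_less_iff[OF prod_dom_nonempty bdd, of t] by auto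
      \<comment> \<open>Splice the witnesses of failure into \<open>b0\<close>: where \<open>b\<close> is a witness, \<open>D (g i (b i)) > t\<close>;
        elsewhere eventually \<open>g i (b0 i) < t < \<Delta>\<close>, so \<open>D (g i (b0 i)) \<ge> \<Delta> > t\<close> by the fixed
        point. Hence \<open>?S < t\<close> can only hold because \<open>h i (b i) < t\<close> eventually.\<close>
      define b where "b i = (if \<exists>c\<in>universe (M i). t < min (D (g i c)) (min \<Delta> (h i c))
        then SOME c. c \<in> universe (M i) \<and> t < min (D (g i c)) (min \<Delta> (h i c)) else b0 i)" for i
      have wit: "b i \<in> universe (M i) \<and> t < min (D (g i (b i))) (min \<Delta> (h i (b i)))"
        if "\<exists>c\<in>universe (M i). t < min (D (g i c)) (min \<Delta> (h i c))" for i
        using someI_ex[of "\<lambda>c. c \<in> universe (M i) \<and> t < min (D (g i c)) (min \<Delta> (h i c))"] that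
        unfolding b_def by auto
      have b: "b \<in> prod_dom M"
        unfolding prod_dom_def
      proof (intro CollectI allI)
        fix i show "b i \<in> universe (M i)"
          using wit[of i] b0(1) by (auto simp: b_def prod_dom_def)
      qed
      have "eventually (\<lambda>i. g i (b0 i) < t) F"
        by (rule eventually_rlimsup_less[OF proper gb[OF b0(1)] b0(2)])
      then have "eventually (\<lambda>i. t \<le> D (g i (b i))) F"
      proof eventually_elim
        case (elim i)
        show ?case
        proof (cases "\<exists>c\<in>universe (M i). t < min (D (g i c)) (min \<Delta> (h i c))")
          case True
          then show ?thesis using wit[of i] by simp
        next
          case no_witness: False
          then have "b i = b0 i" unfolding b_def by (rule if_not_P)
          moreover have "D \<Delta> \<le> D (g i (b0 i))"
            using elim False by (intro antimonoD[OF D(2)]) simp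
          ultimately show ?thesis using D(3) False by simp
        qed
      qed
      then have t_le: "t \<le> D (rlimsup F (\<lambda>i. g i (b i)))"
        by (rule antimono_rlimsup(2)[OF proper gb[OF b] D(1,2)])
      have "min (D (rlimsup F (\<lambda>i. g i (b i)))) (min \<Delta> (rlimsup F (\<lambda>i. h i (b i)))) \<le> ?S"
        by (intro cSUP_upper[OF b] bdd_aboveI[of _ \<Delta>]) auto
      also have "?S < t" using t by (rule le_less_trans[OF max.cobounded2])
      finally have "rlimsup F (\<lambda>i. h i (b i)) < t"
        using t_le False by (simp only: min_less_iff_disj) simp
      then have "eventually (\<lambda>i. h i (b i) < t) F"
        by (rule eventually_rlimsup_less[OF proper hb[OF b]])
      then show ?thesis
      proof eventually_elim
        case (elim i)
        show ?case
        proof (rule cSUP_least[OF universe_nonempty], rule ccontr)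
          \<comment> \<open>Such a \<open>c\<close> would make \<open>b i\<close> a chosen witness,
            whence \<open>h i (b i)\<close> > \<open>t\<close>.\<close>
          fix c assume c: "c \<in> universe (M i)" "\<not> min (D (g i c)) (min \<Delta> (h i c)) \<le> t"
          then have "t < min (D (g i (b i))) (min \<Delta> (h i (b i)))"
            using wit[of i] unfolding not_le by blast
          then show False using elim by simp
        qed
      qed
    qed
    with m_ev have "eventually (\<lambda>i. max (?m i) (?s i) \<le> t) F" by eventually_elim simp
    then show "rlimsup F (\<lambda>i. max (?m i) (?s i)) \<le> t" by (rule rlimsup_le[OF proper theta])
  qed
qed


section \<open>Terms and Palyutin formulas in the reduced product, by induction\<close>

section \<open>Evaluation in reduced products\<close>

lemma trm_val_reduced:
  assumes "wf_trm L t" "\<And>v. v \<in> vars_trm t \<Longrightarrow> a v \<in> prod_dom M"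
  shows "(\<lambda>i. trm_val (M i) (\<lambda>v. a v i) t) \<in> prod_dom M"
    and "trm_val (reduced_product F M) (\<lambda>v. rp_class F M (a v)) t =
           rp_class F M (\<lambda>i. trm_val (M i) (\<lambda>v. a v i) t)"
proof -
  have dom: "(\<lambda>i. trm_val (M i) (\<lambda>v. a v i) t) \<in> prod_dom M"
    if "wf_trm L t" "\<And>v. v \<in> vars_trm t \<Longrightarrow> a v \<in> prod_dom M" for t
    using that by (auto simp: prod_dom_def intro!: trm_val_in_universe[OF struct])
  show "(\<lambda>i. trm_val (M i) (\<lambda>v. a v i) t) \<in> prod_dom M"
    using assms by (rule dom)
  show "trm_val (reduced_product F M) (\<lambda>v. rp_class F M (a v)) t =
          rp_class F M (\<lambda>i. trm_val (M i) (\<lambda>v. a v i) t)"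
    using assms
  proof (induction t)
    case (Var v)
    then show ?case by simp
  next
    case (Fun f ts)
    let ?as = "map (\<lambda>t i. trm_val (M i) (\<lambda>v. a v i) t) ts"
    have "map (trm_val (reduced_product F M) (\<lambda>v. rp_class F M (a v))) ts = map (rp_class F M) ?as"
      using Fun by auto
    moreover have "x \<in> prod_dom M" if "x \<in> set ?as" for x
      using that Fun.prems by (auto intro!: dom)
    ultimately show ?case
      using fint_reduced(2)[of f ?as] Fun.prems(1) by (simp only: trm_val.simps) (simp add: comp_def)
  qed
qed

lemma fm_val_family_bounded:
  assumes "palyutin L \<phi>"
  obtains B where "\<And>i s. (\<forall>v\<in>free_vars \<phi>. s v \<in> universe (M i)) \<Longrightarrow> \<bar>fm_val (M i) s \<phi>\<bar> \<le> B"
  using fm_val_bounded[OF palyutin_wf[OF assms], where ?'a = 'a] struct by blast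

text \<open>Supplies the bounds on \<open>g\<close> and \<open>h\<close> for the interchange lemmas:
  one constant for all factors and all values of the quantified variable.\<close>

lemma fm_val_fun_upd_bounded:
  assumes "palyutin L \<phi>" "\<forall>w\<in>free_vars \<phi> - {v}. a w \<in> prod_dom M"
  obtains B where "\<And>i c. c \<in> universe (M i) \<Longrightarrow> \<bar>fm_val (M i) ((\<lambda>w. a w i)(v := c)) \<phi>\<bar> \<le> B"
proof -
  obtain B where "\<And>i s. (\<forall>v\<in>free_vars \<phi>. s v \<in> universe (M i)) \<Longrightarrow> \<bar>fm_val (M i) s \<phi>\<bar> \<le> B"
    using fm_val_family_bounded[OF assms(1)] by blast
  then show thesis using assms(2) by (intro that[of B]) (auto simp: prod_dom_def)
qed

text \<open>Carries the induction hypothesis under a quantifier. Updating an assignment commutes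
  both with passing to classes and with evaluation at \<open>i\<close>, so the hypothesis applies to
  \<open>a(v := b)\<close>.\<close>

lemma fm_val_reduced_fun_upd:
  assumes "\<And>a. \<forall>w\<in>free_vars \<phi>. a w \<in> prod_dom M \<Longrightarrow>
      fm_val (reduced_product F M) (\<lambda>v. rp_class F M (a v)) \<phi> =
        rlimsup F (\<lambda>i. fm_val (M i) (\<lambda>v. a v i) \<phi>)"
    and "\<forall>w\<in>free_vars \<phi> - {v}. a w \<in> prod_dom M" "b \<in> prod_dom M"
  shows "fm_val (reduced_product F M) ((\<lambda>w. rp_class F M (a w))(v := rp_class F M b)) \<phi> =
           rlimsup F (\<lambda>i. fm_val (M i) ((\<lambda>w. a w i)(v := b i)) \<phi>)"
proof -
  have "(\<lambda>w. rp_class F M (a w))(v := rp_class F M b) = (\<lambda>w. rp_class F M ((a(v := b)) w))"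
    "\<And>i. (\<lambda>w. a w i)(v := b i) = (\<lambda>w. (a(v := b)) w i)"
    by (simp_all add: fun_eq_iff)
  then show ?thesis using assms(1)[of "a(v := b)"] assms(2,3) by simp
qed

text \<open>The assignment is arbitrary in the induction because quantifiers change it. Each case
  then reduces to a statement on bounded real families, namely the values in the factors.\<close>

theorem palyutin_bipreserved:
  assumes "palyutin L \<phi>" "\<forall>v\<in>free_vars \<phi>. a v \<in> prod_dom M"
  shows "fm_val (reduced_product F M) (\<lambda>v. rp_class F M (a v)) \<phi> =
           rlimsup F (\<lambda>i. fm_val (M i) (\<lambda>v. a v i) \<phi>)"
  using assms
proof (induction arbitrary: a rule: palyutin.induct)
  case (palyutin_Pred p ts)
  let ?as = "map (\<lambda>t i. trm_val (M i) (\<lambda>v. a v i) t) ts"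
  have "map (trm_val (reduced_product F M) (\<lambda>v. rp_class F M (a v))) ts = map (rp_class F M) ?as"
    using palyutin_Pred by (auto intro!: trm_val_reduced(2))
  moreover have "x \<in> prod_dom M" if "x \<in> set ?as" for x
    using that palyutin_Pred by (auto intro!: trm_val_reduced(1))
  ultimately show ?case
    using pint_reduced[of p ?as] palyutin_Pred.hyps by (simp only: fm_val.simps) (simp add: comp_def)
next
  case (palyutin_Dist t u)
  then show ?case
    by (simp add: trm_val_reduced mdst_reduced)
next
  case (palyutin_Unary \<phi> C)
  obtain B where "\<And>i s. (\<forall>v\<in>free_vars \<phi>. s v \<in> universe (M i)) \<Longrightarrow> \<bar>fm_val (M i) s \<phi>\<bar> \<le> B"
    using fm_val_family_bounded[OF palyutin_Unary.hyps(1)] by blast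
  then have "\<bar>fm_val (M i) (\<lambda>v. a v i) \<phi>\<bar> \<le> B" for i
    using palyutin_Unary.prems by (auto simp: prod_dom_def Unary_fm_def)
  then show ?case
    using palyutin_Unary rlimsup_continuous_mono[OF proper, of _ B C]
    by (simp add: Unary_fm_def)
next
  case (palyutin_Max \<phi> \<psi>)
  obtain B where "\<And>i s. (\<forall>v\<in>free_vars \<phi>. s v \<in> universe (M i)) \<Longrightarrow> \<bar>fm_val (M i) s \<phi>\<bar> \<le> B"
    using fm_val_family_bounded[OF palyutin_Max.hyps(1)] by blast
  then have \<phi>: "\<bar>fm_val (M i) (\<lambda>v. a v i) \<phi>\<bar> \<le> B" for i
    using palyutin_Max.prems by (auto simp: prod_dom_def Max_fm_def)
  obtain B' where "\<And>i s. (\<forall>v\<in>free_vars \<psi>. s v \<in> universe (M i)) \<Longrightarrow> \<bar>fm_val (M i) s \<psi>\<bar> \<le> B'"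
    using fm_val_family_bounded[OF palyutin_Max.hyps(2)] by blast
  then have \<psi>: "\<bar>fm_val (M i) (\<lambda>v. a v i) \<psi>\<bar> \<le> B'" for i
    using palyutin_Max.prems by (auto simp: prod_dom_def Max_fm_def)
  show ?case
    using palyutin_Max.IH[of a] palyutin_Max.prems by (simp add: Max_fm_def rlimsup_max[OF proper \<phi> \<psi>])
next
  case (palyutin_Inf \<phi> v)
  have a: "\<forall>w\<in>free_vars \<phi> - {v}. a w \<in> prod_dom M"
    using palyutin_Inf.prems by simp
  obtain B where "\<And>i c. c \<in> universe (M i) \<Longrightarrow> \<bar>fm_val (M i) ((\<lambda>w. a w i)(v := c)) \<phi>\<bar> \<le> B"
    using fm_val_fun_upd_bounded[OF palyutin_Inf.hyps a] by blast
  \<comment> \<open>The universe is the image of \<open>prod_dom M\<close>, so the quantifier over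
    classes becomes one over elements \<open>b\<close> of the product.\<close>
  from INF_rlimsup[OF this] show ?case
    by (simp add: universe_reduced image_image fm_val_reduced_fun_upd[OF palyutin_Inf.IH a])
next
  case (palyutin_Sup \<phi> v)
  have a: "\<forall>w\<in>free_vars \<phi> - {v}. a w \<in> prod_dom M"
    using palyutin_Sup.prems by simp
  obtain B where "\<And>i c. c \<in> universe (M i) \<Longrightarrow> \<bar>fm_val (M i) ((\<lambda>w. a w i)(v := c)) \<phi>\<bar> \<le> B"
    using fm_val_fun_upd_bounded[OF palyutin_Sup.hyps a] by blast
  from SUP_rlimsup[OF this] show ?case
    by (simp add: universe_reduced image_image fm_val_reduced_fun_upd[OF palyutin_Sup.IH a])
next
  case (palyutin_Rel \<phi> \<psi> D \<Delta> v)
  have a: "\<forall>w\<in>free_vars \<phi> - {v}. a w \<in> prod_dom M" "\<forall>w\<in>free_vars \<psi> - {v}. a w \<in> prod_dom M"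
    using palyutin_Rel.prems by (auto simp: Max_fm_def Min_fm_def Unary_fm_def)
  obtain B where B: "\<And>i c. c \<in> universe (M i) \<Longrightarrow> \<bar>fm_val (M i) ((\<lambda>w. a w i)(v := c)) \<phi>\<bar> \<le> B"
    using fm_val_fun_upd_bounded[OF palyutin_Rel.hyps(1) a(1)] by blast
  obtain B' where B': "\<And>i c. c \<in> universe (M i) \<Longrightarrow> \<bar>fm_val (M i) ((\<lambda>w. a w i)(v := c)) \<psi>\<bar> \<le> B'"
    using fm_val_fun_upd_bounded[OF palyutin_Rel.hyps(2) a(2)] by blast
  \<comment> \<open>In the reduced product the connectives act on values that are limits superior by
    the induction hypotheses, hence \<open>D\<close> outside \<open>rlimsup\<close> on the left of
    the lemma.\<close>
  from relative_SUP_rlimsup[OF B B' palyutin_Rel.hyps(3-5)] show ?case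
    by (simp add: Max_fm_def Min_fm_def Unary_fm_def Const_fm_def universe_reduced image_image
        fm_val_reduced_fun_upd[OF palyutin_Rel.IH(1) a(1)] fm_val_reduced_fun_upd[OF palyutin_Rel.IH(2) a(2)])
qed

end

theorem proposition3p3:
  fixes L :: "('f, 'p) signature"
    and F :: "'i filter"
    and M :: "'i \<Rightarrow> ('f, 'p, 'a) mstruct"
    and \<phi> :: "('f, 'p) fm"
    and x :: "nat set"
    and a :: "nat \<Rightarrow> 'i \<Rightarrow> 'a"
  assumes "metric_signature L"
    and "palyutin L \<phi>"
    and "free_vars \<phi> \<subseteq> x"
    and "F \<noteq> bot"
    and "\<And>i. L_structure L (M i)"
    and "\<And>v. v \<in> x \<Longrightarrow> a v \<in> prod_dom M"
  shows "fm_val (reduced_product F M) (\<lambda>v. rp_class F M (a v)) \<phi> =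
           rlimsup F (\<lambda>i. fm_val (M i) (\<lambda>v. a v i) \<phi>)"
proof -
  interpret structure_family L F M using assms by unfold_locales
  show ?thesis using assms by (intro palyutin_bipreserved) auto
qed

end
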